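(* Let $n\ge2$ and $1\le\ell\le n-1$. For an $\ell$-element subset $E$ of $\mathbb{Z}_n$, let $\mathbf{P}^{n,\ell}_E$ and $\mathbf{P}^{n,\ell,\mathrm{TASEP}}_E$ denote the laws, started from $X_0=E$, of the continuous-time Markov chains $(X_t)_{t\ge0}$ on $\ell$-element subsets of $\mathbb{Z}_n$ described in the context. Then for every initial state $E$ and every $t\ge0$, $$\frac{\mathrm{d}\mathbf{P}_E^{n,\ell,\mathrm{TASEP}}}{\mathrm{d}\mathbf{P}_E^{n,\ell}}\Big|_{\mathcal{F}_t}=\frac{\Delta(X_0)}{\Delta(X_t)}\exp\left\{\int_0^t\left(\mathrm{Traffic}(X_s)-c_{n,\ell}\right)\mathrm{d}s\right\},\qquad c_{n,\ell}=\ell-\frac{\sin(\pi\ell/n)}{\sin(\pi/n)},$$ where $\mathcal{F}_t:=\sigma(X_s:0\le s\le t)$ is the natural filtration.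
   Context: $\iota=\sqrt{-1}$; $\mathbb{Z}_n=\mathbb{Z}/n\mathbb{Z}$. For $E=\{h_1,\ldots,h_\ell\}\subseteq\mathbb{Z}_n$ with $\ell$ elements, $\Delta(E):=\prod_{1\le j<k\le\ell}|e^{2\pi\iota h_k/n}-e^{2\pi\iota h_j/n}|$ and $\mathrm{Traffic}(E):=\#\{h\in E:h+1\in E\}$. $\mathbf{P}^{n,\ell}$ governs the Markov chain of $\ell$ independent Poisson walkers on the ring conditioned never to collide (equivalently the occupation process of the Gibbs bead measure on $\mathbb{R}\times\mathbb{Z}_n$ with occupation number $\ell$ and density $\frac1n\frac{\sin(\pi\ell/n)}{\sin(\pi/n)}$ of beads per string): the chain jumps from $E$ to $E'=(E\setminus\{h\})\cup\{h+1\}$, for each $h\in E$ with $h+1\notin E$, at rate $\Delta(E')/\Delta(E)$, and makes no other jumps. $\mathbf{P}^{n,\ell,\mathrm{TASEP}}$ governs TASEP with $\ell$ particles on the ring $\mathbb{Z}_n$: the chain jumps from $E$ to $E'=(E\setminus\{h\})\cup\{h+1\}$, for each $h\in E$ with $h+1\notin E$, at rate $1$, and makes no other jumps. *)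

theory Defs
  imports "HOL-Probability.Probability"
begin

section \<open>Continuous-time Markov chains on a finite state space\<close>

text \<open>A chain on a finite set \<open>S\<close> is specified by its jump rates: \<open>q x y\<close> is the rate of the
  jump from \<open>x\<close> to \<open>y\<close>, for \<open>x \<noteq> y\<close>.\<close>

definition generator :: "'s set \<Rightarrow> ('s \<Rightarrow> 's \<Rightarrow> real) \<Rightarrow> 's \<Rightarrow> 's \<Rightarrow> real" where
  "generator S q x y = (if x = y then - (\<Sum>z\<in>S - {x}. q x z) else q x y)"

fun matrix_pow :: "'s set \<Rightarrow> ('s \<Rightarrow> 's \<Rightarrow> real) \<Rightarrow> nat \<Rightarrow> 's \<Rightarrow> 's \<Rightarrow> real" where
  "matrix_pow S Q 0 x y = (if x = y then 1 else 0)"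
| "matrix_pow S Q (Suc k) x y = (\<Sum>z\<in>S. Q x z * matrix_pow S Q k z y)"

text \<open>The transition function is the matrix exponential \<open>exp (t Q)\<close> of the generator, written as
  its (entrywise convergent) power series.\<close>

definition transition :: "'s set \<Rightarrow> ('s \<Rightarrow> 's \<Rightarrow> real) \<Rightarrow> real \<Rightarrow> 's \<Rightarrow> 's \<Rightarrow> real" where
  "transition S q t x y = (\<Sum>k. t ^ k / fact k * matrix_pow S (generator S q) k x y)"

text \<open>Right-continuous paths with left limits in the discrete space \<open>S\<close>, that is,
  right-continuous step functions with finitely many jumps in every bounded time interval.
  Paths are extensional functions: only their values at times \<open>t \<ge> 0\<close> carry information.\<close>

definition rcll :: "(real \<Rightarrow> 's) \<Rightarrow> bool" where
  "rcll \<omega> \<longleftrightarrow> (\<forall>t\<ge>0. \<forall>\<^sub>F s in at_right t. \<omega> s = \<omega> t) \<and>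
            (\<forall>t>0. \<exists>x. \<forall>\<^sub>F s in at_left t. \<omega> s = x)"

definition path_space :: "'s set \<Rightarrow> (real \<Rightarrow> 's) measure" where
  "path_space S = restrict_space (\<Pi>\<^sub>M t\<in>{0..}. count_space S) {\<omega>. rcll \<omega>}"

text \<open>The filtration \<open>\<sigma>(X\<^sub>s : 0 \<le> s \<le> t)\<close> of the coordinate process \<open>X\<^sub>s \<omega> = \<omega> s\<close>. (As a value
  of type \<open>measure\<close>; only its \<open>\<sigma>\<close>-algebra is relevant.)\<close>

definition natural_filtration :: "'s set \<Rightarrow> real \<Rightarrow> (real \<Rightarrow> 's) measure" where
  "natural_filtration S t = sigma (space (path_space S))
     {{\<omega> \<in> space (path_space S). \<omega> s \<in> A} | s A. 0 \<le> s \<and> s \<le> t \<and> A \<subseteq> S}"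

text \<open>\<open>ctmc_law S q x P\<close>: the probability measure \<open>P\<close> on path space is the law, started from
  \<open>x\<close>, of the Markov chain on \<open>S\<close> with jump rates \<open>q\<close>. The finite-dimensional distributions
  determine \<open>P\<close> uniquely.\<close>

definition ctmc_law ::
    "'s set \<Rightarrow> ('s \<Rightarrow> 's \<Rightarrow> real) \<Rightarrow> 's \<Rightarrow> (real \<Rightarrow> 's) measure \<Rightarrow> bool" where
  "ctmc_law S q x P \<longleftrightarrow> prob_space P \<and> sets P = sets (path_space S) \<and>
     (\<forall>(k::nat) (\<tau> :: nat \<Rightarrow> real) (y :: nat \<Rightarrow> 's).
        \<tau> 0 = 0 \<longrightarrow> (\<forall>i<k. \<tau> i \<le> \<tau> (Suc i)) \<longrightarrow> (\<forall>i\<le>k. y i \<in> S) \<longrightarrow>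
        measure P {\<omega> \<in> space P. \<forall>i\<le>k. \<omega> (\<tau> i) = y i} =
          (if y 0 = x then 1 else 0) *
          (\<Prod>i<k. transition S q (\<tau> (Suc i) - \<tau> i) (y i) (y (Suc i))))"

section \<open>Particle configurations on the ring\<close>

text \<open>The ring of integers modulo \<open>n\<close> is represented by the residues \<open>{..<n}\<close>, with successor
  \<open>h \<mapsto> (h + 1) mod n\<close>.\<close>

definition configs :: "nat \<Rightarrow> nat \<Rightarrow> nat set set" where
  "configs n l = {E. E \<subseteq> {..<n} \<and> card E = l}"

definition ring_succ :: "nat \<Rightarrow> nat \<Rightarrow> nat" where
  "ring_succ n h = (h + 1) mod n"

definition Vandermonde :: "nat \<Rightarrow> nat set \<Rightarrow> real" where
  "Vandermonde n E = (\<Prod>(j, k) \<in> {(j, k). j \<in> E \<and> k \<in> E \<and> j < k}.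
     cmod (cis (2 * pi * real k / real n) - cis (2 * pi * real j / real n)))"

definition Traffic :: "nat \<Rightarrow> nat set \<Rightarrow> nat" where
  "Traffic n E = card {h \<in> E. ring_succ n h \<in> E}"

definition jump :: "nat \<Rightarrow> nat set \<Rightarrow> nat set \<Rightarrow> bool" where
  "jump n E E' \<longleftrightarrow> (\<exists>h\<in>E. ring_succ n h \<notin> E \<and> E' = (E - {h}) \<union> {ring_succ n h})"

definition walker_rate :: "nat \<Rightarrow> nat set \<Rightarrow> nat set \<Rightarrow> real" where
  "walker_rate n E E' = (if jump n E E' then Vandermonde n E' / Vandermonde n E else 0)"

definition tasep_rate :: "nat \<Rightarrow> nat set \<Rightarrow> nat set \<Rightarrow> real" where
  "tasep_rate n E E' = (if jump n E E' then 1 else 0)"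

definition c_const :: "nat \<Rightarrow> nat \<Rightarrow> real" where
  "c_const n l = real l - sin (pi * real l / real n) / sin (pi / real n)"

definition tasep_density :: "nat \<Rightarrow> nat \<Rightarrow> real \<Rightarrow> (real \<Rightarrow> nat set) \<Rightarrow> real" where
  "tasep_density n l t \<omega> = Vandermonde n (\<omega> 0) / Vandermonde n (\<omega> t) *
     exp (LINT s:{0..t}|lborel. real (Traffic n (\<omega> s)) - c_const n l)"

end

theory Submission
  imports Defs
begin

text \<open>Let \<open>Q\<close> be the generator of the conditioned walkers, \<open>Q'\<close> that of TASEP, and \<open>\<Delta>\<close> the
  Vandermonde product. The whole theorem rests on one identity between matrices,
  \<open>Q' = \<Delta> Q \<Delta>\<inverse> + V\<close>, where \<open>\<Delta>\<close> and \<open>V = Traffic - c\<close> are read as diagonal matrices: a chain whose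
  generator is conjugate to \<open>Q\<close> up to a potential has, with respect to the \<open>Q\<close>-chain, a density that
  is a ratio of values of \<open>\<Delta>\<close> (Doob transform) times the exponential of the integrated potential
  (Feynman and Kac).

  Off the diagonal the identity is the definition of the rates. On the diagonal it says that the total
  jump rate of the walkers does not depend on the configuration, i.e. that \<open>\<Delta>\<close> is an eigenvector
  of the adjacency matrix of the jumps (\<open>Vandermonde_eigenvector\<close>): TASEP leaves \<open>E\<close> at rate
  \<open>l - Traffic E\<close>, the walkers at rate \<open>sin (\<pi> l / n) / sin (\<pi> / n)\<close>. A ratio \<open>\<Delta>(E') / \<Delta>(E)\<close> is a
  product of ratios of sines, the product vanishes for a blocked particle, and so the eigenvalue
  equation is a trigonometric identity (\<open>sum_prod_sin_ratio\<close>), which comes from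
  comparing top coefficients in Lagrange's interpolation formula.

  To pass from generators to path measures, sample the path at the times \<open>t i / 2 ^ m\<close>. The law of
  the sample is a product of one-step weights, so multiplying it by the density in which the integral is
  replaced by a Riemann sum again gives a product of one-step weights, of the form
  \<open>(\<Delta> exp(\<delta> Q) \<Delta>\<inverse> exp(\<delta> V))(y, z)\<close> with \<open>\<delta> = t / 2 ^ m\<close>. These weights and \<open>exp(\<delta> Q')(y, z)\<close> have the same
  value and the same derivative at \<open>\<delta> = 0\<close>, hence differ by \<open>o(\<delta>)\<close>; over \<open>2 ^ m = t / \<delta>\<close> steps the errors
  add up to \<open>o(1)\<close> even in the \<open>L\<^sup>1\<close>-norm on the set of all sampled paths
  (\<open>path_weights_asymptotically_equal\<close>). This is the argument behind the Lie-Trotter product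
  formula. Paths are right-continuous with finitely many values, so the Riemann sums converge pathwise and boundedly
  (\<open>dyadic_Riemann_sums\<close>), and the limit identifies the two measures on all events that depend on
  finitely many dyadic times. Again by right-continuity these events generate the
  filtration, and they are stable under intersection, so the measures agree on it.\<close>

section \<open>A trigonometric identity from Lagrange interpolation\<close>

text \<open>The case \<open>q = 1\<close> gives the monic node polynomials of Lagrange interpolation, general \<open>q\<close> the
  polynomial that is interpolated below.\<close>

lemma coeff_prod_linear:
  fixes c :: "'i \<Rightarrow> 'a::comm_ring_1"
  assumes "finite I"
  shows "degree (\<Prod>k\<in>I. [:c k, q:]) \<le> card I \<and> coeff (\<Prod>k\<in>I. [:c k, q:]) (card I) = q ^ card I"
  using assms
proof (induction I)
  case (insert i I)
  have "degree ([:c i, q:] * (\<Prod>k\<in>I. [:c k, q:])) \<le> degree [:c i, q:] + degree (\<Prod>k\<in>I. [:c k, q:])"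
    by (rule degree_mult_le)
  moreover have "degree [:c i, q:] \<le> 1" by simp
  ultimately show ?case using insert by (simp add: coeff_eq_0)
qed simp

text \<open>Compare the coefficients of \<open>X ^ (card A - 1)\<close> in Lagrange's formula: every basis polynomial
  \<open>\<Prod>b\<in>A-{a}. (X - b) / (a - b)\<close> has degree exactly \<open>card A - 1\<close>.\<close>

lemma Lagrange_top_coeff:
  fixes A :: "'a::field set"
  assumes "finite A" "degree p < card A"
  shows "coeff p (card A - 1) = (\<Sum>a\<in>A. poly p a / (\<Prod>b\<in>A-{a}. a - b))"
proof -
  define L where "L a = smult (poly p a / (\<Prod>b\<in>A-{a}. a - b)) (\<Prod>b\<in>A-{a}. [:-b, 1:])" for a
  have cA: "card A \<ge> 1" using assms by linarith
  have card: "card (A - {a}) = card A - 1" if "a \<in> A" for a using that by simp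
  have deg: "degree (L a) \<le> card A - 1" and coeff: "coeff (L a) (card A - 1) = poly p a / (\<Prod>b\<in>A-{a}. a - b)"
    if "a \<in> A" for a
    using coeff_prod_linear[of "A - {a}" uminus 1] card[OF that] assms(1)
    by (auto simp: L_def)
  have "p = (\<Sum>a\<in>A. L a)"
  proof (rule poly_eqI_degree)
    fix x assume x: "x \<in> A"
    have "poly (L a) x = 0" if "a \<in> A - {x}" for a
      using that x assms(1) by (auto simp: L_def poly_prod)
    moreover have "poly (L x) x = poly p x"
      using assms(1) by (simp add: L_def poly_prod)
    ultimately show "poly p x = poly (\<Sum>a\<in>A. L a) x"
      by (simp add: poly_sum sum.remove[OF assms(1) x])
  next
    have "degree (\<Sum>a\<in>A. L a) \<le> card A - 1" by (rule degree_sum_le) (use deg assms in auto)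
    thus "card A > degree (\<Sum>a\<in>A. L a)" using cA by linarith
  qed (use assms in auto)
  hence "coeff p (card A - 1) = (\<Sum>a\<in>A. coeff (L a) (card A - 1))" by (metis coeff_sum)
  thus ?thesis using coeff by simp
qed

text \<open>Interpolate \<open>\<Prod>k. (q X - z k)\<close>, of degree at most \<open>card I\<close>, in the nodes \<open>z k\<close> together with the
  additional node \<open>0\<close>, and read off the coefficient \<open>q ^ card I\<close> of \<open>X ^ card I\<close>. The node \<open>0\<close> contributes
  \<open>1\<close>. At the node \<open>z h\<close> the factor \<open>q z h - z h\<close> of the value cancels against the factor
  \<open>z h - 0\<close> of the denominator and leaves \<open>q - 1\<close>.\<close>

lemma sum_prod_q_difference:
  fixes z :: "'i \<Rightarrow> 'a::field"
  assumes fin: "finite I" and inj: "inj_on z I" and nz: "\<And>i. i \<in> I \<Longrightarrow> z i \<noteq> 0"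
  shows "(q - 1) * (\<Sum>h\<in>I. \<Prod>k\<in>I-{h}. (q * z h - z k) / (z h - z k)) = q ^ card I - 1"
proof -
  define F where "F = (\<Prod>k\<in>I. [:- z k, q:])"
  define A where "A = insert 0 (z ` I)"
  have A: "finite A" "card A = Suc (card I)" "0 \<notin> z ` I"
    using fin nz inj by (auto simp: A_def card_image card_insert_if)
  have top: "degree F < card A" "coeff F (card A - 1) = q ^ card I"
    using coeff_prod_linear[OF fin, of "\<lambda>k. - z k" q] A by (auto simp: F_def)
  have node: "poly F (z h) / (\<Prod>b\<in>A-{z h}. z h - b)
      = (q - 1) * (\<Prod>k\<in>I-{h}. (q * z h - z k) / (z h - z k))" if h: "h \<in> I" for h
  proof -
    have "A - {z h} = insert 0 (z ` (I - {h}))"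
      using h inj nz by (auto simp: A_def inj_on_def)
    moreover have "0 \<notin> z ` (I - {h})" "inj_on z (I - {h})" using A(3) inj by (auto simp: inj_on_def)
    ultimately have "(\<Prod>b\<in>A-{z h}. z h - b) = z h * (\<Prod>k\<in>I-{h}. z h - z k)"
      using fin by (simp add: prod.reindex)
    moreover have "poly F (z h) = z h * ((q - 1) * (\<Prod>k\<in>I-{h}. q * z h - z k))"
      unfolding F_def poly_prod by (subst prod.remove[OF fin h]) (simp add: algebra_simps)
    ultimately show ?thesis using nz[OF h] by (simp only: prod_dividef) simp
  qed
  have "A - {0} = z ` I" using A(3) by (auto simp: A_def)
  hence zero: "poly F 0 / (\<Prod>b\<in>A-{0}. 0 - b) = 1"
    using inj nz fin by (simp add: F_def poly_prod prod.reindex)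
  have "q ^ card I = (\<Sum>a\<in>A. poly F a / (\<Prod>b\<in>A-{a}. a - b))"
    using Lagrange_top_coeff[OF A(1) top(1)] top(2) by simp
  also have "\<dots> = 1 + (\<Sum>h\<in>I. poly F (z h) / (\<Prod>b\<in>A-{z h}. z h - b))"
    unfolding A_def using fin A(3) inj zero by (simp add: sum.reindex A_def)
  finally show ?thesis by (simp add: node sum_distrib_left)
qed

text \<open>The midpoint formula for chords of the unit circle; it turns differences of points of the circle into
  sines.\<close>

lemma cis_double_diff: "cis (2 * a) - cis (2 * b) = 2 * \<i> * sin (a - b) * cis (a + b)"
proof -
  have "cis (2 * a) - cis (2 * b) = cis (a + b) * (cis (a - b) - cis (- (a - b)))"
    by (simp add: right_diff_distrib cis_mult algebra_simps)
  also have "cis u - cis (- u) = 2 * \<i> * sin u" for u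
    by (simp add: complex_eq_iff)
  finally show ?thesis by (simp add: mult_ac)
qed

text \<open>The preceding identity for \<open>z h = cis (2 x h)\<close> and \<open>q = cis (2 a)\<close>: each ratio
  \<open>(q z h - z k) / (z h - z k)\<close> is a ratio of sines times the phase \<open>cis a\<close>, and the \<open>card I - 1\<close>
  phases of a product cancel against those of \<open>(q ^ card I - 1) / (q - 1)\<close>.\<close>

lemma sum_prod_sin_ratio:
  fixes x :: "'i \<Rightarrow> real"
  assumes fin: "finite I" and nz: "\<And>h k. h \<in> I \<Longrightarrow> k \<in> I \<Longrightarrow> h \<noteq> k \<Longrightarrow> sin (x h - x k) \<noteq> 0"
    and a: "sin a \<noteq> 0"
  shows "(\<Sum>h\<in>I. \<Prod>k\<in>I-{h}. sin (x h - x k + a) / sin (x h - x k)) = sin (real (card I) * a) / sin a"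
proof (cases "I = {}")
  case False
  define z where "z h = cis (2 * x h)" for h
  define q where "q = cis (2 * a)"
  have inj: "inj_on z I"
  proof (rule inj_onI, rule ccontr)
    fix h k assume *: "h \<in> I" "k \<in> I" "z h = z k" "h \<noteq> k"
    hence "2 * \<i> * sin (x h - x k) * cis (x h + x k) = 0"
      using cis_double_diff[of "x h" "x k"] by (simp add: z_def)
    thus False using nz[of h k] * by simp
  qed
  have ratio: "(q * z h - z k) / (z h - z k) = cis a * of_real (sin (x h - x k + a) / sin (x h - x k))" for h k
  proof -
    have "q * z h - z k = cis (2 * (x h + a)) - cis (2 * x k)"
      by (simp add: q_def z_def cis_mult algebra_simps)
    also have "\<dots> = 2 * \<i> * sin (x h + a - x k) * cis (x h + a + x k)"
      by (rule cis_double_diff)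
    also have "cis (x h + a + x k) = cis a * cis (x h + x k)"
      by (simp add: cis_mult add_ac)
    finally have "q * z h - z k = (cis a * sin (x h - x k + a)) * (2 * \<i> * cis (x h + x k))"
      by (simp add: algebra_simps)
    moreover have "z h - z k = of_real (sin (x h - x k)) * (2 * \<i> * cis (x h + x k))"
      by (simp add: z_def cis_double_diff)
    ultimately show ?thesis by (simp only: nonzero_mult_divide_mult_cancel_right) simp
  qed
  have "(q - 1) * (\<Sum>h\<in>I. \<Prod>k\<in>I-{h}. (q * z h - z k) / (z h - z k)) = q ^ card I - 1"
    by (rule sum_prod_q_difference[OF fin inj]) (simp add: z_def)
  moreover have "(\<Prod>k\<in>I-{h}. (q * z h - z k) / (z h - z k)) =
     cis (real (card I - 1) * a) * of_real (\<Prod>k\<in>I-{h}. sin (x h - x k + a) / sin (x h - x k))" if "h \<in> I" for h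
    unfolding ratio prod.distrib using that fin
    by (simp add: Complex.DeMoivre)
  ultimately have "(q - 1) * (cis (real (card I - 1) * a) *
      of_real (\<Sum>h\<in>I. \<Prod>k\<in>I-{h}. sin (x h - x k + a) / sin (x h - x k))) = q ^ card I - 1"
    by (simp add: sum_distrib_left)
  also have "q ^ card I - 1 = 2 * \<i> * sin (real (card I) * a) * cis (real (card I) * a)"
    using cis_double_diff[of "real (card I) * a" 0] by (simp add: q_def Complex.DeMoivre mult_ac)
  also have "q - 1 = 2 * \<i> * sin a * cis a"
    using cis_double_diff[of a 0] by (simp add: q_def)
  also have "cis (real (card I) * a) = cis a * cis (real (card I - 1) * a)"
  proof -
    have "card I > 0" using False fin by (simp add: card_gt_0_iff)
    thus ?thesis by (simp add: cis_mult of_nat_diff algebra_simps)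
  qed
  finally have "complex_of_real (sin a * (\<Sum>h\<in>I. \<Prod>k\<in>I-{h}. sin (x h - x k + a) / sin (x h - x k)))
     = of_real (sin (real (card I) * a))" by simp
  hence "sin a * (\<Sum>h\<in>I. \<Prod>k\<in>I-{h}. sin (x h - x k + a) / sin (x h - x k)) = sin (real (card I) * a)"
    by (subst (asm) of_real_eq_iff)
  thus ?thesis using a by (simp add: field_simps)
qed simp

section \<open>The Vandermonde product as an eigenvector of the jump matrix\<close>

text \<open>The chord length is symmetric, so the pairs that contain \<open>a\<close> may be indexed by the
  other member, on whichever side of \<open>a\<close> it lies.\<close>

lemma Vandermonde_insert:
  assumes "finite F" "a \<notin> F"
  shows "Vandermonde n (insert a F) = Vandermonde n F *
     (\<Prod>k\<in>F. cmod (cis (2 * pi * real a / real n) - cis (2 * pi * real k / real n)))"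
proof -
  define f where "f = (\<lambda>(j, k). cmod (cis (2 * pi * real k / real n) - cis (2 * pi * real j / real n)))"
  define P where "P = {(j, k). j \<in> F \<and> k \<in> F \<and> j < k}"
  define h where "h = (\<lambda>k. if a < k then (a, k) else (k, a))"
  have "P \<subseteq> F \<times> F" by (auto simp: P_def)
  hence fP: "finite P" using assms(1) by (meson finite_SigmaI finite_subset)
  have eq: "{(j, k). j \<in> insert a F \<and> k \<in> insert a F \<and> j < k} = P \<union> h ` F"
  proof (intro subset_antisym subsetI)
    fix p assume "p \<in> {(j, k). j \<in> insert a F \<and> k \<in> insert a F \<and> j < k}"
    then obtain j k where p: "p = (j, k)" "j \<in> insert a F" "k \<in> insert a F" "j < k" by auto
    consider "j = a" "k \<in> F" | "k = a" "j \<in> F" | "j \<in> F" "k \<in> F" using p by auto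
    thus "p \<in> P \<union> h ` F"
    proof cases
      case 1
      hence "p = h k" using p by (simp add: h_def)
      thus ?thesis using 1 by simp
    next
      case 2
      hence "p = h j" using p by (simp add: h_def)
      thus ?thesis using 2 by simp
    qed (use p in \<open>simp add: P_def\<close>)
  next
    fix p assume "p \<in> P \<union> h ` F"
    thus "p \<in> {(j, k). j \<in> insert a F \<and> k \<in> insert a F \<and> j < k}"
      using assms(2) by (auto simp: P_def h_def split: if_splits) (metis linorder_neqE_nat)
  qed
  have disj: "P \<inter> h ` F = {}" using assms(2) by (auto simp: P_def h_def split: if_splits)
  have inj: "inj_on h F" using assms(2) by (auto simp: inj_on_def h_def split: if_splits)
  have "Vandermonde n (insert a F) = prod f P * prod f (h ` F)"
    unfolding Vandermonde_def f_def[symmetric] eq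
    by (rule prod.union_disjoint) (use fP assms disj in auto)
  also have "prod f (h ` F) = (\<Prod>k\<in>F. cmod (cis (2 * pi * real a / real n) - cis (2 * pi * real k / real n)))"
    unfolding prod.reindex[OF inj] by (rule prod.cong) (auto simp: h_def f_def norm_minus_commute)
  finally show ?thesis by (simp add: Vandermonde_def f_def P_def)
qed

lemma chord_length:
  "cmod (cis (2 * pi * real h / real n) - cis (2 * pi * real k / real n)) = 2 * \<bar>sin (pi * (real h - real k) / real n)\<bar>"
  using cis_double_diff[of "pi * real h / real n" "pi * real k / real n"]
  by (simp add: norm_mult right_diff_distrib diff_divide_distrib mult_ac)

lemma sin_pi_fraction_ge_zero:
  assumes "0 \<le> d" "d \<le> r" "r > 0"
  shows "sin (pi * d / r) \<ge> 0"
proof (rule sin_ge_zero)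
  have "pi * (d / r) \<le> pi * 1" using assms by (intro mult_left_mono) auto
  thus "pi * d / r \<le> pi" by simp
qed (use assms in simp)

lemma sin_pi_fraction_gt_zero:
  assumes "0 < d" "d < r"
  shows "sin (pi * d / r) > 0"
proof (rule sin_gt_zero)
  have "pi * (d / r) < pi * 1" using assms by (intro mult_strict_left_mono) auto
  thus "pi * d / r < pi" by simp
qed (use assms in simp)

lemma sin_chord_nonzero:
  assumes "h < n" "k < n" "h \<noteq> k"
  shows "sin (pi * (real h - real k) / real n) \<noteq> 0"
proof -
  have pos: "sin (pi * (real h - real k) / real n) > 0" if "h < n" "k < h" for h k
    by (rule sin_pi_fraction_gt_zero) (use that in auto)
  show ?thesis
  proof (cases "k < h")
    case False
    have "sin (pi * (real h - real k) / real n) = - sin (pi * (real k - real h) / real n)"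
      by (simp flip: sin_minus add: minus_divide_left algebra_simps)
    thus ?thesis using pos[of k h] assms False by simp
  qed (use pos[of h k] assms in simp)
qed

lemma finite_config: "E \<in> configs n l \<Longrightarrow> finite E"
  by (auto simp: configs_def intro: finite_subset)

lemma finite_configs: "finite (configs n l)"
  by (rule finite_subset[of _ "Pow {..<n}"]) (auto simp: configs_def)

lemma Vandermonde_pos:
  assumes "E \<in> configs n l"
  shows "Vandermonde n E > 0"
proof -
  have "cis (2 * pi * real k / real n) \<noteq> cis (2 * pi * real j / real n)"
    if "j \<in> E" "k \<in> E" "j < k" for j k
    using chord_length[of k n j] sin_chord_nonzero[of k n j] that assms by (auto simp: configs_def)
  thus ?thesis unfolding Vandermonde_def by (intro prod_pos) auto
qed

text \<open>A chord length is \<open>2 \<bar>sin (\<pi> d / n)\<bar>\<close> with \<open>d = h - k\<close>, and the absolute values cancel in the ratio: moving \<open>h\<close>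
  one step ahead replaces \<open>d\<close> by \<open>d + 1\<close>, and as \<open>0 < \<bar>d\<bar> < n\<close> this stays within \<open>{0..n}\<close> or within
  \<open>{-n..0}\<close>, so the two sines have the same sign or the numerator vanishes.\<close>

lemma chord_ratio:
  assumes "h < n" "k < n" "h \<noteq> k"
  shows "cmod (cis (2 * pi * real (ring_succ n h) / real n) - cis (2 * pi * real k / real n)) /
     cmod (cis (2 * pi * real h / real n) - cis (2 * pi * real k / real n)) =
     sin (pi * real h / real n - pi * real k / real n + pi / real n) / sin (pi * real h / real n - pi * real k / real n)"
proof -
  have n: "n > 0" using assms by simp
  have succ: "cis (2 * pi * real (ring_succ n h) / real n) = cis (2 * pi * real (h + 1) / real n)"
  proof (cases "h + 1 = n")
    case True
    hence "ring_succ n h = 0" "2 * pi * real (h + 1) / real n = 2 * pi" using n by (auto simp: ring_succ_def)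
    thus ?thesis by (simp only:) simp
  next
    case False
    thus ?thesis using assms by (simp add: ring_succ_def)
  qed
  define d where "d = (real h - real k)"
  have angle: "pi * real h / real n - pi * real k / real n = pi * d / n"
     "pi * real h / real n - pi * real k / real n + pi / n = pi * (d + 1) / n"
    by (simp_all add: d_def diff_divide_distrib add_divide_distrib right_diff_distrib distrib_left)
  have lhs: "\<bar>sin (pi * (d + 1) / n)\<bar> / \<bar>sin (pi * d / n)\<bar> = sin (pi * (d + 1) / n) / sin (pi * d / n)"
  proof (cases "k < h")
    case True
    have "sin (pi * (d + 1) / n) \<ge> 0" "sin (pi * d / n) \<ge> 0"
      by (rule sin_pi_fraction_ge_zero; use True assms in \<open>simp add: d_def\<close>)+
    thus ?thesis by simp
  next
    case False
    have "sin (pi * (- d - 1) / n) \<ge> 0" "sin (pi * (- d) / n) \<ge> 0"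
      by (rule sin_pi_fraction_ge_zero; use False assms in \<open>simp add: d_def\<close>)+
    moreover have "pi * (- d - 1) / n = - (pi * (d + 1) / n)" "pi * (- d) / n = - (pi * d / n)"
      by (simp_all add: diff_divide_distrib add_divide_distrib right_diff_distrib distrib_left)
    ultimately have "sin (pi * (d + 1) / n) \<le> 0" "sin (pi * d / n) \<le> 0"
      by (simp_all only: sin_minus neg_0_le_iff_le)
    thus ?thesis by simp
  qed
  have shift: "real (h + 1) - real k = d + 1" "real h - real k = d" by (simp_all add: d_def)
  show ?thesis unfolding succ chord_length angle(2) shift unfolding angle(1) using lhs by simp
qed

lemma Vandermonde_move_ratio:
  assumes E: "E \<in> configs n l" and h: "h \<in> E" "ring_succ n h \<notin> E"
  shows "Vandermonde n ((E - {h}) \<union> {ring_succ n h}) / Vandermonde n E =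
    (\<Prod>k\<in>E-{h}. sin (pi * real h / n - pi * real k / n + pi / n) / sin (pi * real h / n - pi * real k / n))"
proof -
  have fin: "finite (E - {h})" using finite_config[OF E] by simp
  have "Vandermonde n E = Vandermonde n (insert h (E - {h}))" using h by (simp add: insert_absorb)
  hence D: "Vandermonde n E = Vandermonde n (E - {h}) *
     (\<Prod>k\<in>E-{h}. cmod (cis (2 * pi * real h / real n) - cis (2 * pi * real k / real n)))"
    using Vandermonde_insert[OF fin, of h n] by simp
  have "Vandermonde n (E - {h}) \<noteq> 0" using D Vandermonde_pos[OF E] by auto
  hence "Vandermonde n ((E - {h}) \<union> {ring_succ n h}) / Vandermonde n E =
    (\<Prod>k\<in>E-{h}. cmod (cis (2 * pi * real (ring_succ n h) / real n) - cis (2 * pi * real k / real n)) /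
       cmod (cis (2 * pi * real h / real n) - cis (2 * pi * real k / real n)))"
    using Vandermonde_insert[OF fin, of "ring_succ n h" n] h Vandermonde_pos[OF E] D
    by (simp add: prod_dividef)
  also have "\<dots> = (\<Prod>k\<in>E-{h}. sin (pi * real h / n - pi * real k / n + pi / n) / sin (pi * real h / n - pi * real k / n))"
    by (rule prod.cong[OF refl], rule chord_ratio) (use E h in \<open>auto simp: configs_def\<close>)
  finally show ?thesis .
qed

text \<open>The product for a particle \<open>h\<close> whose successor is occupied contains the factor \<open>sin 0\<close> or
  \<open>sin \<pi>\<close> (the latter when \<open>h\<close> passes from \<open>n - 1\<close> to \<open>0\<close>). The sum may therefore be extended
  to all particles, to which the trigonometric identity applies with shift \<open>\<pi> / n\<close>.\<close>

lemma Vandermonde_eigenvector: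
  assumes E: "E \<in> configs n l" and n: "n \<ge> 2"
  shows "(\<Sum>h\<in>{h\<in>E. ring_succ n h \<notin> E}. Vandermonde n ((E - {h}) \<union> {ring_succ n h}) / Vandermonde n E)
     = sin (pi * real l / real n) / sin (pi / real n)"
proof -
  let ?r = "\<lambda>h. \<Prod>k\<in>E-{h}. sin (pi * real h / n - pi * real k / n + pi / n) / sin (pi * real h / n - pi * real k / n)"
  have fin: "finite E" by (rule finite_config[OF E])
  have blocked: "?r h = 0" if h: "h \<in> E" "ring_succ n h \<in> E" for h
  proof -
    have hn: "h < n" using E h by (auto simp: configs_def)
    have "ring_succ n h \<noteq> h"
      using hn n by (cases "h + 1 = n") (auto simp: ring_succ_def)
    moreover have "sin (pi * real h / n - pi * real (ring_succ n h) / n + pi / n) = 0"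
    proof (cases "h + 1 = n")
      case True
      hence "real n = real h + 1" "ring_succ n h = 0" by (auto simp: ring_succ_def)
      hence "pi * real h / n - pi * real (ring_succ n h) / n + pi / n = pi * (real h + 1) / (real h + 1)"
        by (simp add: add_divide_distrib distrib_left)
      thus ?thesis by simp
    next
      case False
      thus ?thesis using hn n by (simp add: ring_succ_def field_simps)
    qed
    ultimately show ?thesis using h fin by (auto intro!: prod_zero bexI[of _ "ring_succ n h"])
  qed
  have "(\<Sum>h\<in>{h\<in>E. ring_succ n h \<notin> E}. Vandermonde n ((E - {h}) \<union> {ring_succ n h}) / Vandermonde n E)
     = (\<Sum>h\<in>{h\<in>E. ring_succ n h \<notin> E}. ?r h)"
    by (rule sum.cong) (use Vandermonde_move_ratio[OF E] in auto)
  also have "\<dots> = (\<Sum>h\<in>E. ?r h)"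
    by (rule sum.mono_neutral_left) (use fin blocked in auto)
  also have "\<dots> = sin (real (card E) * (pi / n)) / sin (pi / n)"
  proof (rule sum_prod_sin_ratio[OF fin])
    fix h k assume "h \<in> E" "k \<in> E" "h \<noteq> k"
    thus "sin (pi * real h / n - pi * real k / n) \<noteq> 0"
      using sin_chord_nonzero[of h n k] E by (auto simp: configs_def right_diff_distrib diff_divide_distrib)
  next
    have "sin (pi * 1 / n) > 0" using n by (intro sin_pi_fraction_gt_zero) auto
    thus "sin (pi / n) \<noteq> 0" by simp
  qed
  also have "real (card E) * (pi / n) = pi * real l / n" using E by (simp add: configs_def)
  finally show ?thesis .
qed

section \<open>The generators of TASEP and of the walkers are conjugate up to a potential\<close>

text \<open>Distinct particles lead to distinct configurations, since the moved particle is the only element of \<open>E\<close>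
  missing from the new configuration.\<close>

lemma sum_over_jumps:
  assumes E: "E \<in> configs n l"
  shows "(\<Sum>E'\<in>configs n l - {E}. if jump n E E' then f E' else 0)
     = (\<Sum>h\<in>{h\<in>E. ring_succ n h \<notin> E}. f ((E - {h}) \<union> {ring_succ n h}))"
proof -
  let ?H = "{h\<in>E. ring_succ n h \<notin> E}" and ?m = "\<lambda>h. (E - {h}) \<union> {ring_succ n h}"
  have inj: "inj_on ?m ?H"
  proof (rule inj_onI)
    fix h k assume hk: "h \<in> ?H" "k \<in> ?H" "?m h = ?m k"
    have "E - ?m h = {h}" using hk(1) by auto
    moreover have "E - ?m k = {k}" using hk(2) by auto
    ultimately have "{h} = {k}" unfolding hk(3) by (rule trans[OF sym])
    thus "h = k" by simp
  qed
  have sub: "?m ` ?H \<subseteq> configs n l - {E}"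
  proof
    fix E' assume "E' \<in> ?m ` ?H"
    then obtain h where h: "h \<in> E" "ring_succ n h \<notin> E" "E' = ?m h" by auto
    have "h < n" using E h by (auto simp: configs_def)
    hence "ring_succ n h < n" by (simp add: ring_succ_def)
    moreover have "card E' = Suc (card (E - {h}))" using h finite_config[OF E] by simp
    hence "card E' = card E" using card.remove[OF finite_config[OF E] h(1)] by simp
    ultimately show "E' \<in> configs n l - {E}" using E h by (auto simp: configs_def)
  qed
  have "(\<Sum>E'\<in>configs n l - {E}. if jump n E E' then f E' else 0) = (\<Sum>E'\<in>?m ` ?H. f E')"
  proof (rule sum.mono_neutral_cong_right)
    show "\<forall>i\<in>configs n l - {E} - ?m ` ?H. (if jump n E i then f i else 0) = 0"
      by (auto simp: jump_def)
    show "(if jump n E i then f i else 0) = f i" if "i \<in> ?m ` ?H" for i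
      using that by (auto simp: jump_def)
  qed (use finite_configs sub in auto)
  also have "\<dots> = (\<Sum>h\<in>?H. f (?m h))" by (simp only: sum.reindex[OF inj] o_def)
  finally show ?thesis .
qed

text \<open>Off the diagonal the Vandermonde ratio undoes the one in the walker rates. On the diagonal,
  \<open>l - Traffic\<close> particles can jump in TASEP, and the exit rate of the walkers is the eigenvalue.\<close>

lemma tasep_generator_conjugate:
  assumes n: "n \<ge> 2" and x: "x \<in> configs n l" and y: "y \<in> configs n l"
  shows "generator (configs n l) (tasep_rate n) x y =
     Vandermonde n x / Vandermonde n y * generator (configs n l) (walker_rate n) x y
     + (if x = y then real (Traffic n y) - c_const n l else 0)"
proof (cases "x = y")
  case True
  have fin: "finite x" by (rule finite_config[OF x])
  have "(\<Sum>z\<in>configs n l - {x}. tasep_rate n x z) = real (card {h\<in>x. ring_succ n h \<notin> x})"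
    unfolding tasep_rate_def sum_over_jumps[OF x, of "\<lambda>_. 1"] by simp
  moreover have "card {h\<in>x. ring_succ n h \<notin> x} + Traffic n x = l"
  proof -
    have "card {h\<in>x. ring_succ n h \<notin> x} + card {h\<in>x. ring_succ n h \<in> x} =
        card ({h\<in>x. ring_succ n h \<notin> x} \<union> {h\<in>x. ring_succ n h \<in> x})"
      using fin by (intro card_Un_disjoint[symmetric]) auto
    also have "{h\<in>x. ring_succ n h \<notin> x} \<union> {h\<in>x. ring_succ n h \<in> x} = x" by auto
    finally show ?thesis using x by (simp add: Traffic_def configs_def)
  qed
  moreover have "(\<Sum>z\<in>configs n l - {x}. walker_rate n x z) = sin (pi * real l / real n) / sin (pi / real n)"
    unfolding walker_rate_def sum_over_jumps[OF x, of "\<lambda>z. Vandermonde n z / Vandermonde n x"]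
    using Vandermonde_eigenvector[OF x n] by simp
  ultimately show ?thesis
    using True Vandermonde_pos[OF x] by (auto simp: generator_def c_const_def)
next
  case False
  thus ?thesis using Vandermonde_pos[OF x] Vandermonde_pos[OF y]
    by (simp add: generator_def tasep_rate_def walker_rate_def)
qed

section \<open>Short-time behaviour of the transition function\<close>

text \<open>A crude bound: the sum of the absolute values of all entries is submultiplicative. It gives the
  convergence of the exponential series for every time.\<close>

lemma abs_matrix_pow_le:
  assumes "finite S" "x \<in> S"
  shows "\<bar>matrix_pow S Q k x y\<bar> \<le> (\<Sum>x\<in>S. \<Sum>z\<in>S. \<bar>Q x z\<bar>) ^ k"
  using assms(2)
proof (induction k arbitrary: x)
  case (Suc k)
  let ?M = "\<Sum>x\<in>S. \<Sum>z\<in>S. \<bar>Q x z\<bar>"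
  have M: "?M \<ge> 0" by (intro sum_nonneg) auto
  have "\<bar>matrix_pow S Q (Suc k) x y\<bar> \<le> (\<Sum>z\<in>S. \<bar>Q x z\<bar> * \<bar>matrix_pow S Q k z y\<bar>)"
    by (simp flip: abs_mult)
  also have "\<dots> \<le> (\<Sum>z\<in>S. \<bar>Q x z\<bar> * ?M ^ k)"
    by (intro sum_mono mult_left_mono Suc.IH) auto
  also have "\<dots> = (\<Sum>z\<in>S. \<bar>Q x z\<bar>) * ?M ^ k" by (simp add: sum_distrib_right)
  also have "\<dots> \<le> ?M * ?M ^ k"
    using M assms(1) Suc.prems
    by (intro mult_right_mono member_le_sum[where f = "\<lambda>x. \<Sum>z\<in>S. \<bar>Q x z\<bar>"]) (auto intro: sum_nonneg)
  finally show ?case by simp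
qed simp

lemma transition_at_zero: "transition S q 0 x y = (if x = y then 1 else 0)"
proof -
  have "transition S q 0 x y = (\<Sum>k. (if k = 0 then matrix_pow S (generator S q) 0 x y else 0))"
    unfolding transition_def by (rule suminf_cong) auto
  also have "\<dots> = matrix_pow S (generator S q) 0 x y"
    using sums_single[of 0 "\<lambda>k. matrix_pow S (generator S q) 0 x y"] by (simp add: sums_iff)
  finally show ?thesis by simp
qed

text \<open>With the value at \<open>0\<close> this is the expansion \<open>exp (\<delta> Q) = 1 + \<delta> Q + o(\<delta>)\<close> by which one-step weights
  are compared. The coefficients of the power series are \<open>Q ^ k / k!\<close>, so the derivative at \<open>0\<close> is the
  coefficient \<open>Q\<close> for \<open>k = 1\<close>.\<close>

lemma transition_has_derivative_generator:
  assumes S: "finite S" and xy: "x \<in> S" "y \<in> S"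
  shows "((\<lambda>\<delta>. transition S q \<delta> x y) has_real_derivative generator S q x y) (at 0)"
proof -
  define Q where "Q = generator S q"
  define c where "c k = matrix_pow S Q k x y / fact k" for k
  let ?M = "\<Sum>x\<in>S. \<Sum>z\<in>S. \<bar>Q x z\<bar>"
  have sm: "summable (\<lambda>k. c k * u ^ k)" for u
  proof (rule summable_comparison_test', rule summable_exp)
    fix k :: nat
    have "norm (c k * u ^ k) = \<bar>matrix_pow S Q k x y\<bar> * \<bar>u\<bar> ^ k / fact k"
      by (simp add: c_def abs_mult power_abs)
    also have "\<dots> \<le> ?M ^ k * \<bar>u\<bar> ^ k / fact k"
      by (intro divide_right_mono mult_right_mono abs_matrix_pow_le S xy) auto
    finally show "norm (c k * u ^ k) \<le> inverse (fact k) * (?M * \<bar>u\<bar>) ^ k"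
      by (simp add: power_mult_distrib field_simps)
  qed
  have "(\<Sum>n. diffs c n * 0 ^ n) = diffs c 0" by (rule powser_zero)
  also have "\<dots> = Q x y"
  proof -
    have "(\<Sum>z\<in>S. Q x z * (if z = y then 1 else 0)) = Q x y"
      using S xy by (simp add: if_distrib cong: if_cong)
    thus ?thesis by (simp add: diffs_def c_def)
  qed
  finally have "((\<lambda>\<delta>. \<Sum>k. c k * \<delta> ^ k) has_real_derivative Q x y) (at 0)"
    using termdiffs_strong_converges_everywhere[OF sm, of 0] by simp
  moreover have "transition S q \<delta> x y = (\<Sum>k. c k * \<delta> ^ k)" for \<delta>
    by (simp add: transition_def c_def Q_def mult_ac)
  ultimately show ?thesis by (simp add: Q_def)
qed

section \<open>Products of one-step weights along discrete paths\<close>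

text \<open>Discrete paths are extensional functions on \<open>{..N}\<close>, so that they form a finite set when
  \<open>S\<close> is finite.\<close>

definition paths_from :: "'s set \<Rightarrow> 's \<Rightarrow> nat \<Rightarrow> (nat \<Rightarrow> 's) set" where
  "paths_from S x N = {y \<in> {..N} \<rightarrow>\<^sub>E S. y 0 = x}"

definition path_weight :: "('s \<Rightarrow> 's \<Rightarrow> real) \<Rightarrow> nat \<Rightarrow> (nat \<Rightarrow> 's) \<Rightarrow> real" where
  "path_weight a N y = (\<Prod>i<N. a (y i) (y (Suc i)))"

lemma paths_from_0: "x \<in> S \<Longrightarrow> paths_from S x 0 = {\<lambda>i\<in>{0}. x}"
  by (auto simp: paths_from_def PiE_def extensional_def fun_eq_iff)

text \<open>Splitting off the last step gives the induction for sums over all paths.\<close>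

lemma sum_paths_from_Suc:
  "sum f (paths_from S x (Suc N)) = (\<Sum>y\<in>paths_from S x N. \<Sum>z\<in>S. f (y(Suc N := z)))"
proof -
  let ?e = "\<lambda>(z, y). y(Suc N := z)"
  have "paths_from S x (Suc N) = ?e ` (S \<times> paths_from S x N)"
  proof -
    have "{..Suc N} \<rightarrow>\<^sub>E S = ?e ` (S \<times> ({..N} \<rightarrow>\<^sub>E S))"
      unfolding atMost_Suc by (rule PiE_insert_eq)
    thus ?thesis by (auto simp: paths_from_def image_iff)
  qed
  moreover have "inj_on ?e (S \<times> paths_from S x N)"
    by (rule inj_on_subset[OF inj_combinator[of "Suc N" "{..N}" "\<lambda>_. S"]]) (auto simp: paths_from_def)
  ultimately have "sum f (paths_from S x (Suc N)) = (\<Sum>(z, y)\<in>S \<times> paths_from S x N. f (y(Suc N := z)))"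
    by (simp add: sum.reindex case_prod_unfold)
  also have "\<dots> = (\<Sum>z\<in>S. \<Sum>y\<in>paths_from S x N. f (y(Suc N := z)))"
    by (simp add: sum.cartesian_product)
  also have "\<dots> = (\<Sum>y\<in>paths_from S x N. \<Sum>z\<in>S. f (y(Suc N := z)))"
    by (rule sum.swap)
  finally show ?thesis .
qed

lemma path_weight_Suc:
  "path_weight a (Suc N) (y(Suc N := z)) = path_weight a N y * a (y N) z"
  unfolding path_weight_def by (auto intro!: prod.cong)

lemma sum_abs_path_weight_le:
  assumes x: "x \<in> S" and r: "r \<ge> 0" "\<And>y. y \<in> S \<Longrightarrow> (\<Sum>z\<in>S. \<bar>b y z\<bar>) \<le> r"
  shows "(\<Sum>y\<in>paths_from S x N. \<bar>path_weight b N y\<bar>) \<le> r ^ N"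
proof (induction N)
  case (Suc N)
  have "(\<Sum>y\<in>paths_from S x (Suc N). \<bar>path_weight b (Suc N) y\<bar>)
      = (\<Sum>y\<in>paths_from S x N. \<bar>path_weight b N y\<bar> * (\<Sum>z\<in>S. \<bar>b (y N) z\<bar>))"
    by (simp add: sum_paths_from_Suc path_weight_Suc abs_mult sum_distrib_left)
  also have "\<dots> \<le> (\<Sum>y\<in>paths_from S x N. \<bar>path_weight b N y\<bar> * r)"
    by (intro sum_mono mult_left_mono r) (auto simp: paths_from_def PiE_def)
  also have "\<dots> \<le> r ^ N * r"
    unfolding sum_distrib_right[symmetric] by (intro mult_right_mono Suc.IH r)
  finally show ?case by (simp add: mult.commute)
qed (simp add: paths_from_0[OF x] path_weight_def)

text \<open>Telescoping, one step at a time: \<open>a a' - b b' = (a - b) a' + b (a' - b')\<close>. The bound is that of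
  the scalar case, in which \<open>b\<close> is the number \<open>r\<close> and \<open>a\<close> the number \<open>r + \<eta>\<close>.\<close>

lemma sum_abs_path_weight_diff_le:
  assumes x: "x \<in> S" and r: "r \<ge> 0" "\<And>y. y \<in> S \<Longrightarrow> (\<Sum>z\<in>S. \<bar>b y z\<bar>) \<le> r"
    and \<eta>: "\<And>y. y \<in> S \<Longrightarrow> (\<Sum>z\<in>S. \<bar>a y z - b y z\<bar>) \<le> \<eta>"
  shows "(\<Sum>y\<in>paths_from S x N. \<bar>path_weight a N y - path_weight b N y\<bar>) \<le> (r + \<eta>) ^ N - r ^ N"
proof (induction N)
  case (Suc N)
  have \<eta>0: "\<eta> \<ge> 0" using \<eta>[OF x] by (meson abs_ge_zero order_trans sum_nonneg)
  let ?D = "\<lambda>y. \<bar>path_weight a N y - path_weight b N y\<bar>"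
  have row: "(\<Sum>z\<in>S. \<bar>a y z\<bar>) \<le> r + \<eta>" if "y \<in> S" for y
  proof -
    have "(\<Sum>z\<in>S. \<bar>a y z\<bar>) \<le> (\<Sum>z\<in>S. \<bar>b y z\<bar> + \<bar>a y z - b y z\<bar>)" by (intro sum_mono) linarith
    thus ?thesis using r(2)[OF that] \<eta>[OF that] by (simp add: sum.distrib)
  qed
  have "(\<Sum>z\<in>S. \<bar>path_weight a N y * a (y N) z - path_weight b N y * b (y N) z\<bar>)
      \<le> ?D y * (r + \<eta>) + \<bar>path_weight b N y\<bar> * \<eta>" if y: "y \<in> paths_from S x N" for y
  proof -
    have yN: "y N \<in> S" using y by (auto simp: paths_from_def PiE_def)
    have "(\<Sum>z\<in>S. \<bar>path_weight a N y * a (y N) z - path_weight b N y * b (y N) z\<bar>)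
       \<le> (\<Sum>z\<in>S. ?D y * \<bar>a (y N) z\<bar> + \<bar>path_weight b N y\<bar> * \<bar>a (y N) z - b (y N) z\<bar>)"
    proof (rule sum_mono)
      fix z
      have "path_weight a N y * a (y N) z - path_weight b N y * b (y N) z =
        (path_weight a N y - path_weight b N y) * a (y N) z + path_weight b N y * (a (y N) z - b (y N) z)"
        by (simp add: algebra_simps)
      thus "\<bar>path_weight a N y * a (y N) z - path_weight b N y * b (y N) z\<bar>
         \<le> ?D y * \<bar>a (y N) z\<bar> + \<bar>path_weight b N y\<bar> * \<bar>a (y N) z - b (y N) z\<bar>"
        by (simp only: abs_mult[symmetric] abs_triangle_ineq)
    qed
    also have "\<dots> = ?D y * (\<Sum>z\<in>S. \<bar>a (y N) z\<bar>) + \<bar>path_weight b N y\<bar> * (\<Sum>z\<in>S. \<bar>a (y N) z - b (y N) z\<bar>)"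
      by (simp add: sum.distrib sum_distrib_left)
    also have "\<dots> \<le> ?D y * (r + \<eta>) + \<bar>path_weight b N y\<bar> * \<eta>"
      by (intro add_mono mult_left_mono row \<eta> yN) auto
    finally show ?thesis .
  qed
  hence "(\<Sum>y\<in>paths_from S x (Suc N). \<bar>path_weight a (Suc N) y - path_weight b (Suc N) y\<bar>)
     \<le> (\<Sum>y\<in>paths_from S x N. ?D y * (r + \<eta>) + \<bar>path_weight b N y\<bar> * \<eta>)"
    by (simp add: sum_paths_from_Suc path_weight_Suc sum_mono)
  also have "\<dots> = (\<Sum>y\<in>paths_from S x N. ?D y) * (r + \<eta>) + (\<Sum>y\<in>paths_from S x N. \<bar>path_weight b N y\<bar>) * \<eta>"
    by (simp add: sum.distrib sum_distrib_right)
  also have "\<dots> \<le> ((r + \<eta>) ^ N - r ^ N) * (r + \<eta>) + r ^ N * \<eta>"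
    using r \<eta>0 x by (intro add_mono mult_right_mono Suc.IH sum_abs_path_weight_le) auto
  finally show ?case by (simp add: algebra_simps)
qed (simp add: paths_from_0[OF x] path_weight_def)

text \<open>A difference quotient of \<open>s \<mapsto> f (t s)\<close>, whose increment \<open>1 / 2 ^ m\<close> is nonzero also when \<open>t = 0\<close>.\<close>

lemma dyadic_difference_quotient:
  fixes f :: "real \<Rightarrow> real"
  assumes "f 0 = 0" "(f has_real_derivative d) (at 0)"
  shows "(\<lambda>m. 2 ^ m * f (t / 2 ^ m)) \<longlonglongrightarrow> t * d"
proof -
  have "((\<lambda>s. f (t * s)) has_real_derivative d * t) (at 0)"
    by (rule DERIV_chain2[where g = "\<lambda>s. t * s"]) (use assms in \<open>auto intro!: derivative_eq_intros\<close>)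
  hence lim: "((\<lambda>h. f (t * h) / h) \<longlongrightarrow> d * t) (at 0)"
    using assms(1) by (simp add: DERIV_def)
  have "(\<lambda>m. (1 / 2) ^ m :: real) \<longlonglongrightarrow> 0" by (rule LIMSEQ_power_zero) simp
  hence "filterlim (\<lambda>m. (1 / 2) ^ m :: real) (at 0) sequentially"
    by (intro filterlim_atI) auto
  from filterlim_compose[OF lim this] show ?thesis
    by (simp add: power_divide mult_ac)
qed

text \<open>The one-step weights \<open>a\<close> and \<open>b\<close> agree at \<open>\<delta> = 0\<close> to first order. With \<open>\<delta> = t / 2 ^ m\<close>, their
  distance \<open>\<eta>\<close> satisfies \<open>2 ^ m \<eta> \<longlonglongrightarrow> 0\<close>, while the absolute row sums of \<open>b\<close> are at most \<open>1 + \<rho>\<close> with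
  \<open>2 ^ m \<rho>\<close> convergent. So the \<open>L\<^sup>1\<close>-distance of the path weights is at most
  \<open>(1 + \<rho> + \<eta>) ^ 2 ^ m - (1 + \<rho>) ^ 2 ^ m \<le> exp (2 ^ m \<rho>) (exp (2 ^ m \<eta>) - 1)\<close>, which tends to \<open>0\<close>.\<close>

lemma path_weights_asymptotically_equal:
  fixes a b :: "real \<Rightarrow> 's \<Rightarrow> 's \<Rightarrow> real"
  assumes S: "finite S" and x: "x \<in> S"
    and id: "\<And>y z. y \<in> S \<Longrightarrow> z \<in> S \<Longrightarrow> a 0 y z = (if y = z then 1 else 0)"
      "\<And>y z. y \<in> S \<Longrightarrow> z \<in> S \<Longrightarrow> b 0 y z = (if y = z then 1 else 0)"
    and deriv: "\<And>y z. y \<in> S \<Longrightarrow> z \<in> S \<Longrightarrow> ((\<lambda>\<delta>. a \<delta> y z) has_real_derivative Q y z) (at 0)"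
      "\<And>y z. y \<in> S \<Longrightarrow> z \<in> S \<Longrightarrow> ((\<lambda>\<delta>. b \<delta> y z) has_real_derivative Q y z) (at 0)"
  shows "(\<lambda>m. \<Sum>y\<in>paths_from S x (2 ^ m).
      \<bar>path_weight (a (t / 2 ^ m)) (2 ^ m) y - path_weight (b (t / 2 ^ m)) (2 ^ m) y\<bar>) \<longlonglongrightarrow> 0"
proof -
  define \<eta> where "\<eta> m = (\<Sum>y\<in>S. \<Sum>z\<in>S. \<bar>a (t / 2 ^ m) y z - b (t / 2 ^ m) y z\<bar>)" for m :: nat
  define \<rho> where "\<rho> m = (\<Sum>y\<in>S. \<Sum>z\<in>S. \<bar>b (t / 2 ^ m) y z - (if y = z then 1 else 0)\<bar>)" for m :: nat
  have D: "((\<lambda>\<delta>. a \<delta> y z - b \<delta> y z) has_real_derivative Q y z - Q y z) (at 0)"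
    "((\<lambda>\<delta>. b \<delta> y z - (if y = z then 1 else 0)) has_real_derivative Q y z - 0) (at 0)"
    if "y \<in> S" "z \<in> S" for y z
    by (intro DERIV_diff deriv that DERIV_const)+
  have "(\<lambda>m. \<Sum>y\<in>S. \<Sum>z\<in>S. \<bar>2 ^ m * (a (t / 2 ^ m) y z - b (t / 2 ^ m) y z)\<bar>)
     \<longlonglongrightarrow> (\<Sum>y\<in>S. \<Sum>z\<in>S. \<bar>t * (Q y z - Q y z)\<bar>)"
    by (intro tendsto_sum tendsto_rabs dyadic_difference_quotient[where f = "\<lambda>\<delta>. a \<delta> u v - b \<delta> u v" for u v])
       (use id D in simp_all)
  hence \<eta>: "(\<lambda>m. 2 ^ m * \<eta> m) \<longlonglongrightarrow> 0"
    by (simp add: \<eta>_def sum_distrib_left abs_mult)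
  have "(\<lambda>m. \<Sum>y\<in>S. \<Sum>z\<in>S. \<bar>2 ^ m * (b (t / 2 ^ m) y z - (if y = z then 1 else 0))\<bar>)
     \<longlonglongrightarrow> (\<Sum>y\<in>S. \<Sum>z\<in>S. \<bar>t * (Q y z - 0)\<bar>)"
    by (intro tendsto_sum tendsto_rabs dyadic_difference_quotient[where f = "\<lambda>\<delta>. b \<delta> u v - (if u = v then 1 else 0)" for u v])
       (use id D in simp_all)
  hence \<rho>: "(\<lambda>m. 2 ^ m * \<rho> m) \<longlonglongrightarrow> (\<Sum>y\<in>S. \<Sum>z\<in>S. \<bar>t * Q y z\<bar>)"
    by (simp add: \<rho>_def sum_distrib_left abs_mult)
  have \<rho>0: "\<rho> m \<ge> 0" and \<eta>0: "\<eta> m \<ge> 0" for m by (auto simp: \<rho>_def \<eta>_def intro!: sum_nonneg)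
  have bound: "(\<Sum>y\<in>paths_from S x (2 ^ m).
      \<bar>path_weight (a (t / 2 ^ m)) (2 ^ m) y - path_weight (b (t / 2 ^ m)) (2 ^ m) y\<bar>)
      \<le> exp (2 ^ m * \<rho> m) * (exp (2 ^ m * \<eta> m) - 1)" for m :: nat
  proof -
    let ?r = "1 + \<rho> m"
    have row_b: "(\<Sum>z\<in>S. \<bar>b (t / 2 ^ m) y z\<bar>) \<le> ?r" if y: "y \<in> S" for y
    proof -
      have "(\<Sum>z\<in>S. \<bar>b (t / 2 ^ m) y z\<bar>)
          \<le> (\<Sum>z\<in>S. (if y = z then 1 else 0) + \<bar>b (t / 2 ^ m) y z - (if y = z then 1 else 0)\<bar>)"
        by (intro sum_mono) auto
      also have "\<dots> = 1 + (\<Sum>z\<in>S. \<bar>b (t / 2 ^ m) y z - (if y = z then 1 else 0)\<bar>)"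
        using S y by (simp add: sum.distrib)
      also have "(\<Sum>z\<in>S. \<bar>b (t / 2 ^ m) y z - (if y = z then 1 else 0)\<bar>) \<le> \<rho> m"
        unfolding \<rho>_def using S y
        by (intro member_le_sum[where f = "\<lambda>y. \<Sum>z\<in>S. \<bar>b (t / 2 ^ m) y z - (if y = z then 1 else 0)\<bar>"])
           (auto intro: sum_nonneg)
      finally show ?thesis by simp
    qed
    have row_diff: "(\<Sum>z\<in>S. \<bar>a (t / 2 ^ m) y z - b (t / 2 ^ m) y z\<bar>) \<le> \<eta> m" if y: "y \<in> S" for y
      unfolding \<eta>_def using S y
      by (intro member_le_sum[where f = "\<lambda>y. \<Sum>z\<in>S. \<bar>a (t / 2 ^ m) y z - b (t / 2 ^ m) y z\<bar>"])
         (auto intro: sum_nonneg)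
    have "(\<Sum>y\<in>paths_from S x (2 ^ m).
      \<bar>path_weight (a (t / 2 ^ m)) (2 ^ m) y - path_weight (b (t / 2 ^ m)) (2 ^ m) y\<bar>)
      \<le> (?r + \<eta> m) ^ (2 ^ m) - ?r ^ (2 ^ m)"
      using \<rho>0[of m] by (intro sum_abs_path_weight_diff_le x row_b row_diff) auto
    \<comment> \<open>factor out \<open>?r \<ge> 1\<close>, so that both factors are compared with exponentials separately\<close>
    also have "(?r + \<eta> m) ^ (2 ^ m) \<le> (?r * (1 + \<eta> m)) ^ (2 ^ m)"
      using \<rho>0[of m] \<eta>0[of m] by (intro power_mono) (auto simp: algebra_simps)
    also have "(?r * (1 + \<eta> m)) ^ (2 ^ m) - ?r ^ (2 ^ m) = ?r ^ (2 ^ m) * ((1 + \<eta> m) ^ (2 ^ m) - 1)"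
      by (simp only: power_mult_distrib right_diff_distrib mult_1_right)
    also have "\<dots> \<le> exp (\<rho> m) ^ (2 ^ m) * (exp (\<eta> m) ^ (2 ^ m) - 1)"
      using \<rho>0[of m] \<eta>0[of m]
      by (intro mult_mono power_mono diff_mono) (auto simp: add.commute exp_ge_add_one_self intro!: one_le_power)
    finally show ?thesis by (simp flip: exp_of_nat_mult)
  qed
  have "(\<lambda>m. exp (2 ^ m * \<rho> m) * (exp (2 ^ m * \<eta> m) - 1))
      \<longlonglongrightarrow> exp (\<Sum>y\<in>S. \<Sum>z\<in>S. \<bar>t * Q y z\<bar>) * (exp 0 - 1)"
    by (intro tendsto_intros \<eta> \<rho>)
  hence "(\<lambda>m. exp (2 ^ m * \<rho> m) * (exp (2 ^ m * \<eta> m) - 1)) \<longlonglongrightarrow> 0" by simp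
  thus ?thesis
    by (rule Lim_null_comparison[rotated]) (use bound in \<open>simp add: sum_nonneg\<close>)
qed

section \<open>Dyadic Riemann sums of right-continuous functions\<close>

text \<open>The half-open dyadic cells \<open>(t k / 2 ^ m, t (k + 1) / 2 ^ m]\<close> cover \<open>(0, t]\<close>.\<close>

lemma dyadic_upper_index:
  fixes s t :: real
  assumes "0 < s" "s \<le> t"
  obtains k where "k < 2 ^ m" "t * real k / 2 ^ m < s" "s \<le> t * real (Suc k) / 2 ^ m"
proof -
  define c where "c = \<lceil>s * 2 ^ m / t\<rceil>"
  have t: "t > 0" using assms by simp
  have c1: "of_int c - 1 < s * 2 ^ m / t" "s * 2 ^ m / t \<le> of_int c"
    unfolding c_def by linarith+
  have "s * 2 ^ m / t > 0" using assms by simp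
  hence c_pos: "c \<ge> 1" using c1 by linarith
  have "c \<le> 2 ^ m" unfolding c_def using assms t by (simp add: ceiling_le_iff field_simps)
  define k where "k = nat (c - 1)"
  have k: "real k = of_int c - 1" "real (Suc k) = of_int c" using c_pos by (simp_all add: k_def)
  show ?thesis
  proof (rule that[of k])
    show "k < 2 ^ m" using \<open>c \<le> 2 ^ m\<close> c_pos by (simp add: k_def nat_less_iff)
    show "t * real k / 2 ^ m < s" using c1(1) t unfolding k by (simp add: field_simps)
    show "s \<le> t * real (Suc k) / 2 ^ m" using c1(2) t unfolding k by (simp add: field_simps)
  qed
qed

lemma dyadic_upper_index_tendsto:
  fixes s t :: real
  assumes j: "\<And>m. t * real (j m) / 2 ^ m < s" "\<And>m. s \<le> t * real (Suc (j m)) / 2 ^ m"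
  shows "(\<lambda>m. t * real (Suc (j m)) / 2 ^ m) \<longlonglongrightarrow> s"
proof (rule tendsto_sandwich[OF _ _ tendsto_const])
  have "(\<lambda>m. s + t * (1 / 2) ^ m) \<longlonglongrightarrow> s + t * 0"
    by (intro tendsto_intros LIMSEQ_power_zero) simp
  thus "(\<lambda>m. s + t * (1 / 2) ^ m) \<longlonglongrightarrow> s" by simp
  have "t * real (Suc (j m)) / 2 ^ m \<le> s + t * (1 / 2) ^ m" for m
    using j(1)[of m] by (simp add: field_simps)
  thus "\<forall>\<^sub>F m in sequentially. t * real (Suc (j m)) / 2 ^ m \<le> s + t * (1 / 2) ^ m" by simp
qed (use j(2) in simp)

lemma dyadic_upper_sequence:
  fixes s t :: real
  assumes "0 < s" "s \<le> t"
  shows "\<exists>j. (\<forall>m. j m < 2 ^ m \<and> t * real (j m) / 2 ^ m < s \<and> s \<le> t * real (Suc (j m)) / 2 ^ m) \<and>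
    (\<lambda>m. t * real (Suc (j m)) / 2 ^ m) \<longlonglongrightarrow> s"
proof -
  have "\<exists>j. j < 2 ^ m \<and> t * real j / 2 ^ m < s \<and> s \<le> t * real (Suc j) / 2 ^ m" for m
    using dyadic_upper_index[OF assms, of m] by metis
  then obtain j where "\<forall>m. j m < 2 ^ m \<and> t * real (j m) / 2 ^ m < s \<and> s \<le> t * real (Suc (j m)) / 2 ^ m"
    by metis
  thus ?thesis using dyadic_upper_index_tendsto[of t j s] by blast
qed

text \<open>The approximating times stay at or above \<open>s\<close>, where right-continuity can be used, and in \<open>[0, t]\<close>. For
  \<open>s = 0\<close>, which lies in no half-open cell, the index is constantly \<open>0\<close>.\<close>

lemma dyadic_from_above:
  fixes s t :: real
  assumes "0 \<le> s" "s \<le> t"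
  shows "\<exists>k. (\<forall>m. k m \<le> 2 ^ m \<and> s \<le> t * real (k m) / 2 ^ m) \<and> (\<lambda>m. t * real (k m) / 2 ^ m) \<longlonglongrightarrow> s"
proof (cases "s = 0")
  case True
  thus ?thesis by (intro exI[of _ "\<lambda>_. 0"]) simp
next
  case False
  with assms obtain j where
    "\<forall>m. j m < 2 ^ m \<and> t * real (j m) / 2 ^ m < s \<and> s \<le> t * real (Suc (j m)) / 2 ^ m"
    "(\<lambda>m. t * real (Suc (j m)) / 2 ^ m) \<longlonglongrightarrow> s"
    using dyadic_upper_sequence[of s t] by auto
  thus ?thesis by (intro exI[of _ "\<lambda>m. Suc (j m)"]) (auto simp: Suc_le_eq)
qed

lemma eventually_along_sequence_from_above:
  fixes s :: real
  assumes c: "c \<longlonglongrightarrow> s" "\<And>m. s \<le> c m" and P: "eventually P (at_right s)" "P s"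
  shows "eventually (\<lambda>m. P (c m)) sequentially"
proof -
  obtain b where b: "b > s" "\<And>u. u > s \<Longrightarrow> u < b \<Longrightarrow> P u"
    using P(1) by (auto simp: eventually_at_right_field)
  have "eventually (\<lambda>m. c m < b) sequentially" using order_tendstoD(2)[OF c(1) b(1)] .
  thus ?thesis by eventually_elim (use b c(2) P(2) in \<open>metis order_le_less\<close>)
qed

text \<open>Evaluate at the right endpoint of each cell: the resulting step function at \<open>s\<close> is the value of \<open>f\<close> at a
  point at or above \<open>s\<close> that tends to \<open>s\<close>, so right-continuity gives convergence at every
  \<open>s \<in> (0, t]\<close>, jump times included. The integrals follow by dominated convergence.\<close>

lemma dyadic_Riemann_sums:
  fixes f :: "real \<Rightarrow> real"
  assumes t: "t \<ge> 0" and bound: "\<And>s. s \<ge> 0 \<Longrightarrow> \<bar>f s\<bar> \<le> K"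
    and rc: "\<And>s. s \<ge> 0 \<Longrightarrow> (f \<longlongrightarrow> f s) (at_right s)"
  shows "(\<lambda>m. \<Sum>i<2 ^ m. t / 2 ^ m * f (t * real (Suc i) / 2 ^ m)) \<longlonglongrightarrow> (LINT s:{0..t}|lborel. f s)"
proof -
  define I where "I m i = {t * real i / 2 ^ m <.. t * real (Suc i) / 2 ^ m}" for m i :: nat
  define u where "u m s = (\<Sum>i<2 ^ m. indicator (I m i) s * f (t * real (Suc i) / 2 ^ m))" for m s
  define g where "g s = indicator {0<..t} s * f s" for s
  have I_disj: "i = i'" if "s \<in> I m i" "s \<in> I m i'" for s m i i'
  proof -
    have *: False if "i < i'" "s \<in> I m i" "s \<in> I m i'" for i i'
    proof -
      have "t * real (Suc i) / 2 ^ m \<le> t * real i' / 2 ^ m"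
        using that(1) t by (intro divide_right_mono mult_left_mono) auto
      thus False using that by (auto simp: I_def)
    qed
    show ?thesis using *[of i i'] *[of i' i] that by (cases i i' rule: linorder_cases) auto
  qed
  have I_sub: "I m i \<subseteq> {0<..t}" if "i < 2 ^ m" for m i
  proof -
    have "real (Suc i) / 2 ^ m \<le> 1" using that by (simp add: Suc_le_eq flip: of_nat_Suc)
    from mult_left_mono[OF this t] have "t * real (Suc i) / 2 ^ m \<le> t" by simp
    moreover have "t * real i / 2 ^ m \<ge> 0" using t by simp
    ultimately show ?thesis by (auto simp: I_def)
  qed
  have u_val: "u m s = f (t * real (Suc i) / 2 ^ m)" if "i < 2 ^ m" "s \<in> I m i" for m s i
  proof -
    have "u m s = (\<Sum>j\<in>{i}. indicator (I m j) s * f (t * real (Suc j) / 2 ^ m))"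
      unfolding u_def using that I_disj
      by (intro sum.mono_neutral_right) (auto simp: indicator_def)
    thus ?thesis using that by simp
  qed
  have u_zero: "u m s = 0" if "s \<notin> {0<..t}" for m s
  proof -
    have "s \<notin> I m i" if "i < 2 ^ m" for i
      using I_sub[OF that] \<open>s \<notin> {0<..t}\<close> by auto
    thus ?thesis unfolding u_def by (intro sum.neutral) auto
  qed
  have K0: "K \<ge> 0" using bound[of 0] by simp
  have u_bound: "\<bar>u m s\<bar> \<le> indicator {0..t} s * K" for m s
  proof (cases "s \<in> {0<..t}")
    case True
    then obtain i where "i < 2 ^ m" "s \<in> I m i"
      using dyadic_upper_index[of s t m] by (auto simp: I_def)
    thus ?thesis using u_val[of i m s] bound[of "t * real (Suc i) / 2 ^ m"] t True by simp
  qed (use u_zero K0 in auto)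
  have lim: "(\<lambda>m. u m s) \<longlonglongrightarrow> g s" for s
  proof (cases "s \<in> {0<..t}")
    case True
    then obtain j where j: "\<forall>m. j m < 2 ^ m \<and> t * real (j m) / 2 ^ m < s \<and> s \<le> t * real (Suc (j m)) / 2 ^ m"
      "(\<lambda>m. t * real (Suc (j m)) / 2 ^ m) \<longlonglongrightarrow> s"
      using dyadic_upper_sequence[of s t] by auto
    have "u m s = f (t * real (Suc (j m)) / 2 ^ m)" for m
      by (rule u_val) (use j(1) in \<open>auto simp: I_def\<close>)
    moreover have "(\<lambda>m. f (t * real (Suc (j m)) / 2 ^ m)) \<longlonglongrightarrow> f s"
    proof (rule tendstoI)
      fix e :: real assume e: "e > 0"
      have "eventually (\<lambda>v. dist (f v) (f s) < e) (at_right s)"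
        using rc[of s] True e by (intro tendstoD) auto
      thus "eventually (\<lambda>m. dist (f (t * real (Suc (j m)) / 2 ^ m)) (f s) < e) sequentially"
        using eventually_along_sequence_from_above[OF j(2), of "\<lambda>v. dist (f v) (f s) < e"] j(1) e by simp
    qed
    ultimately show ?thesis using True by (simp add: g_def)
  qed (use u_zero in \<open>simp add: g_def\<close>)
  have u_meas: "u m \<in> borel_measurable lborel" for m
    unfolding u_def I_def by measurable
  have g_meas: "g \<in> borel_measurable lborel"
    by (rule borel_measurable_LIMSEQ_real[OF lim u_meas])
  have "(\<lambda>m. integral\<^sup>L lborel (u m)) \<longlonglongrightarrow> integral\<^sup>L lborel g"
  proof (rule integral_dominated_convergence[where w = "\<lambda>s. indicator {0..t} s * K"])
    show "integrable lborel (\<lambda>s. indicator {0..t} s * K)"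
      by (intro integrable_mult_left integrable_real_indicator) (auto simp: emeasure_lborel_Icc_eq)
  qed (use u_meas g_meas lim u_bound in auto)
  moreover have "integral\<^sup>L lborel (u m) = (\<Sum>i<2 ^ m. t / 2 ^ m * f (t * real (Suc i) / 2 ^ m))" for m
  proof -
    have meas: "measure lborel (I m i) = t / 2 ^ m" for i
      unfolding I_def using t by (subst measure_lborel_Ioc) (auto simp: field_simps)
    have int: "integrable lborel (\<lambda>s. indicator (I m i) s * f (t * real (Suc i) / 2 ^ m))" for i
    proof -
      have "t * real i / 2 ^ m \<le> t * real (Suc i) / 2 ^ m"
        using t by (intro divide_right_mono mult_left_mono) auto
      from emeasure_lborel_Ioc[OF this] show ?thesis
        unfolding I_def by (intro integrable_mult_left integrable_real_indicator) auto
    qed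
    have "integral\<^sup>L lborel (u m) = (\<Sum>i<2 ^ m. integral\<^sup>L lborel (\<lambda>s. indicator (I m i) s * f (t * real (Suc i) / 2 ^ m)))"
      unfolding u_def[abs_def] by (rule Bochner_Integration.integral_sum) (rule int)
    thus ?thesis by (simp add: meas)
  qed
  moreover have "(LINT s:{0..t}|lborel. f s) = integral\<^sup>L lborel g"
    unfolding set_lebesgue_integral_def
  proof (rule integral_cong_AE)
    \<comment> \<open>\<open>s = 0\<close> lies in no cell, and is the only point of \<open>{0..t}\<close> where the limit of the step functions can differ from \<open>f\<close>\<close>
    have "(\<lambda>s. g s + indicator {0} s * f 0) \<in> borel_measurable lborel"
      using g_meas by measurable
    also have "(\<lambda>s. g s + indicator {0} s * f 0) = (\<lambda>s. indicat_real {0..t} s *\<^sub>R f s)"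
      using t by (auto simp: g_def indicator_def fun_eq_iff)
    finally show "(\<lambda>s. indicat_real {0..t} s *\<^sub>R f s) \<in> borel_measurable lborel" .
    show "AE s in lborel. indicat_real {0..t} s *\<^sub>R f s = g s"
      using AE_lborel_singleton[of 0] by eventually_elim (auto simp: g_def indicator_def)
  qed (rule g_meas)
  ultimately show ?thesis by simp
qed

section \<open>The filtration is generated by dyadic samples\<close>

lemma space_path_space: "space (path_space S) = {\<omega> \<in> {0..} \<rightarrow>\<^sub>E S. rcll \<omega>}"
  by (auto simp: path_space_def space_restrict_space space_PiM)

lemma path_in_states: "\<omega> \<in> space (path_space S) \<Longrightarrow> s \<ge> 0 \<Longrightarrow> \<omega> s \<in> S"
  by (auto simp: space_path_space PiE_def)

lemma path_right_continuous: "\<omega> \<in> space (path_space S) \<Longrightarrow> s \<ge> 0 \<Longrightarrow> \<forall>\<^sub>F u in at_right s. \<omega> u = \<omega> s"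
  by (simp add: space_path_space rcll_def)

lemma coordinate_event:
  assumes "s \<ge> 0" "A \<subseteq> S"
  shows "{\<omega> \<in> space (path_space S). \<omega> s \<in> A} \<in> sets (path_space S)"
proof -
  have "(\<lambda>\<omega>. \<omega> s) \<in> measurable (path_space S) (count_space S)"
    unfolding path_space_def
    by (intro measurable_restrict_space1 measurable_component_singleton) (use assms in auto)
  from measurable_sets[OF this, of A] assms show ?thesis
    by (simp add: vimage_def Int_def conj_commute)
qed

lemma space_natural_filtration: "space (natural_filtration S t) = space (path_space S)"
  unfolding natural_filtration_def by (rule space_measure_of) auto

lemma sets_natural_filtration:
  "sets (natural_filtration S t) = sigma_sets (space (path_space S))
     {{\<omega> \<in> space (path_space S). \<omega> s \<in> A} | s A. 0 \<le> s \<and> s \<le> t \<and> A \<subseteq> S}"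
  unfolding natural_filtration_def by (rule sets_measure_of) auto

lemma subalgebra_natural_filtration:
  assumes "sets P = sets (path_space S)"
  shows "subalgebra P (natural_filtration S t)"
proof -
  have "sets (natural_filtration S t) \<subseteq> sets (path_space S)"
    unfolding sets_natural_filtration
    by (rule sets.sigma_sets_subset) (auto intro: coordinate_event)
  thus ?thesis using assms sets_eq_imp_space_eq[OF assms]
    by (simp add: subalgebra_def space_natural_filtration)
qed

text \<open>Restricting to \<open>{..2 ^ m}\<close> makes the sample take values in the finite set of discrete paths.\<close>

definition sample :: "real \<Rightarrow> nat \<Rightarrow> (real \<Rightarrow> 's) \<Rightarrow> nat \<Rightarrow> 's" where
  "sample t m \<omega> = (\<lambda>i\<in>{..2 ^ m}. \<omega> (t * real i / 2 ^ m))"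

definition sample_event :: "'s set \<Rightarrow> real \<Rightarrow> nat \<Rightarrow> (nat \<Rightarrow> 's) set \<Rightarrow> (real \<Rightarrow> 's) set" where
  "sample_event S t m H = {\<omega> \<in> space (path_space S). sample t m \<omega> \<in> H}"

lemma dyadic_in_interval:
  assumes "i \<le> 2 ^ m" "(t::real) \<ge> 0"
  shows "0 \<le> t * real i / 2 ^ m" "t * real i / 2 ^ m \<le> t"
proof -
  have "real i / 2 ^ m \<le> 1" using assms by simp
  from mult_left_mono[OF this assms(2)] show "t * real i / 2 ^ m \<le> t" by simp
qed (use assms in simp)

lemma sample_in_paths:
  assumes "\<omega> \<in> space (path_space S)" "t \<ge> 0"
  shows "sample t m \<omega> \<in> {..2 ^ m} \<rightarrow>\<^sub>E S"
  using assms by (auto simp: sample_def intro!: path_in_states[OF assms(1)])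

lemma sample_measurable:
  fixes S :: "'s set"
  assumes S: "finite S" and t: "t \<ge> 0"
  shows "sample t m \<in> measurable (natural_filtration S t) (count_space ({..2 ^ m} \<rightarrow>\<^sub>E S))"
proof -
  let ?F = "natural_filtration S t"
  have event: "{\<omega> \<in> space ?F. \<forall>i\<le>2 ^ m. \<omega> (t * real i / 2 ^ m) = y i} \<in> sets ?F"
    if y: "y \<in> {..2 ^ m} \<rightarrow>\<^sub>E S" for y :: "nat \<Rightarrow> 's"
  proof -
    have "{\<omega> \<in> space ?F. \<omega> (t * real i / 2 ^ m) = y i} \<in> sets ?F" if i: "i \<in> {..2 ^ m}" for i
    proof -
      have "{\<omega> \<in> space (path_space S). \<omega> (t * real i / 2 ^ m) \<in> {y i}} \<in> sets ?F"
        unfolding sets_natural_filtration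
      proof (intro sigma_sets.Basic CollectI exI conjI refl)
        show "{y i} \<subseteq> S" using y i by (auto simp: PiE_def)
      qed (use dyadic_in_interval[of i m t] i t in auto)
      thus ?thesis by (simp add: space_natural_filtration)
    qed
    hence "(\<Inter>i\<in>{..2 ^ m}. {\<omega> \<in> space ?F. \<omega> (t * real i / 2 ^ m) = y i}) \<in> sets ?F"
      by (intro sets.finite_INT) auto
    also have "(\<Inter>i\<in>{..2 ^ m}. {\<omega> \<in> space ?F. \<omega> (t * real i / 2 ^ m) = y i})
       = {\<omega> \<in> space ?F. \<forall>i\<le>2 ^ m. \<omega> (t * real i / 2 ^ m) = y i}" by auto
    finally show ?thesis .
  qed
  show ?thesis
  proof (subst measurable_count_space_eq2)
    show "finite ({..2 ^ m :: nat} \<rightarrow>\<^sub>E S)" using S by (simp add: finite_PiE)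
    have preimage: "sample t m -` {y} \<inter> space ?F = {\<omega> \<in> space ?F. \<forall>i\<le>2 ^ m. \<omega> (t * real i / 2 ^ m) = y i}"
      if y: "y \<in> {..2 ^ m} \<rightarrow>\<^sub>E S" for y :: "nat \<Rightarrow> 's"
    proof -
      have "sample t m \<omega> = y \<longleftrightarrow> (\<forall>i\<le>2 ^ m. \<omega> (t * real i / 2 ^ m) = y i)" for \<omega>
        using y by (auto simp: sample_def fun_eq_iff PiE_def extensional_def)
      thus ?thesis by auto
    qed
    have "sample t m \<in> space ?F \<rightarrow> ({..2 ^ m} \<rightarrow>\<^sub>E S)"
      unfolding space_natural_filtration by (rule funcsetI) (rule sample_in_paths[OF _ t])
    moreover have "\<forall>a\<in>{..2 ^ m} \<rightarrow>\<^sub>E S. sample t m -` {a} \<inter> space ?F \<in> sets ?F"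
      by (intro ballI) (simp only: preimage event)
    ultimately show "sample t m \<in> space ?F \<rightarrow> ({..2 ^ m} \<rightarrow>\<^sub>E S) \<and>
      (\<forall>a\<in>{..2 ^ m} \<rightarrow>\<^sub>E S. sample t m -` {a} \<inter> space ?F \<in> sets ?F)" ..
  qed
qed

lemma function_of_sample_measurable:
  assumes "finite S" "t \<ge> 0"
  shows "(\<lambda>\<omega>. \<phi> (sample t m \<omega>) :: real) \<in> borel_measurable (natural_filtration S t)"
  by (rule measurable_compose[OF sample_measurable[OF assms]]) simp

lemma sample_event_measurable:
  assumes "finite S" "t \<ge> 0"
  shows "sample_event S t m H \<in> sets (natural_filtration S t)"
proof -
  have "sample t m -` (H \<inter> ({..2 ^ m} \<rightarrow>\<^sub>E S)) \<inter> space (natural_filtration S t) \<in> sets (natural_filtration S t)"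
    by (rule measurable_sets[OF sample_measurable[OF assms]]) simp
  also have "sample t m -` (H \<inter> ({..2 ^ m} \<rightarrow>\<^sub>E S)) \<inter> space (natural_filtration S t) = sample_event S t m H"
    unfolding sample_event_def space_natural_filtration
    using sample_in_paths[OF _ assms(2), where S = S and m = m] by blast
  finally show ?thesis .
qed

text \<open>The grids are nested, so an event that depends on a coarse sample depends on every finer one. This puts
  finitely many sample events, or a sample event and a fine Riemann sum, on a common grid.\<close>

lemma sample_event_refine:
  assumes "m \<le> m'"
  obtains H' where "sample_event S t m H = sample_event S t m' H'"
proof
  let ?r = "\<lambda>y. \<lambda>i\<in>{..2 ^ m}. y (i * 2 ^ (m' - m))"
  have "?r (sample t m' \<omega>) = sample t m \<omega>" for \<omega> :: "real \<Rightarrow> 'a"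
  proof
    fix i
    show "?r (sample t m' \<omega>) i = sample t m \<omega> i"
    proof (cases "i \<le> 2 ^ m")
      case True
      have eq: "(2::nat) ^ m' = 2 ^ m * 2 ^ (m' - m)" using assms by (simp flip: power_add)
      hence "i * 2 ^ (m' - m) \<le> 2 ^ m'" using True by simp
      moreover have "t * real (i * 2 ^ (m' - m)) / 2 ^ m' = t * real i / 2 ^ m"
      proof -
        have "(2::real) ^ m' = 2 ^ m * 2 ^ (m' - m)" using assms by (simp flip: power_add)
        thus ?thesis by simp
      qed
      ultimately show ?thesis using True by (simp add: sample_def)
    qed (simp add: sample_def)
  qed
  thus "sample_event S t m H = sample_event S t m' {y. ?r y \<in> H}"
    by (simp add: sample_event_def)
qed

lemma Int_stable_sample_events: "Int_stable {sample_event S t m H | m H. True}"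
proof (rule Int_stableI)
  fix a b assume "a \<in> {sample_event S t m H | m H. True}" "b \<in> {sample_event S t m H | m H. True}"
  then obtain m H m' H' where ab: "a = sample_event S t m H" "b = sample_event S t m' H'" by auto
  obtain H1 H2 where "a = sample_event S t (max m m') H1" "b = sample_event S t (max m m') H2"
    using sample_event_refine[of m "max m m'" S t H] sample_event_refine[of m' "max m m'" S t H'] ab
    by (metis max.cobounded1 max.cobounded2)
  hence "a \<inter> b = sample_event S t (max m m') (H1 \<inter> H2)" by (auto simp: sample_event_def)
  thus "a \<inter> b \<in> {sample_event S t m H | m H. True}" by auto
qed

text \<open>By right-continuity the path is constant shortly after \<open>s\<close>, so \<open>X s \<in> A\<close> holds iff \<open>X\<close> is in
  \<open>A\<close> at all but finitely many of a sequence of dyadic times that decreases to \<open>s\<close>.\<close>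

lemma sample_events_generate_filtration:
  assumes S: "finite S" and t: "t \<ge> 0"
  shows "sets (natural_filtration S t) = sigma_sets (space (path_space S)) {sample_event S t m H | m H. True}"
    (is "_ = sigma_sets ?\<Omega> ?G")
proof (rule antisym)
  have sub: "?G \<subseteq> Pow ?\<Omega>" by (auto simp: sample_event_def)
  interpret G: sigma_algebra ?\<Omega> "sigma_sets ?\<Omega> ?G" by (rule sigma_algebra_sigma_sets[OF sub])
  show "sigma_sets ?\<Omega> ?G \<subseteq> sets (natural_filtration S t)"
    using sets.sigma_sets_subset[of ?G "natural_filtration S t"] sample_event_measurable[OF assms]
    by (auto simp: space_natural_filtration)
  show "sets (natural_filtration S t) \<subseteq> sigma_sets ?\<Omega> ?G"
    unfolding sets_natural_filtration
  proof (rule G.sigma_sets_subset, clarify)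
    fix s A assume s: "0 \<le> s" "s \<le> t" and A: "A \<subseteq> S"
    obtain k where k_le: "\<forall>m. k m \<le> 2 ^ m \<and> s \<le> t * real (k m) / 2 ^ m"
      and k_lim: "(\<lambda>m. t * real (k m) / 2 ^ m) \<longlonglongrightarrow> s"
      using dyadic_from_above[OF s] by blast
    define B where "B m = sample_event S t m {y. y (k m) \<in> A}" for m
    have B: "\<omega> \<in> B m \<longleftrightarrow> \<omega> (t * real (k m) / 2 ^ m) \<in> A" if "\<omega> \<in> ?\<Omega>" for \<omega> m
      using that k_le by (simp add: B_def sample_event_def sample_def)
    have ev: "\<forall>\<^sub>F m in sequentially. \<omega> (t * real (k m) / 2 ^ m) = \<omega> s" if "\<omega> \<in> ?\<Omega>" for \<omega>
      by (rule eventually_along_sequence_from_above[OF k_lim])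
         (use k_le path_right_continuous[OF that s(1)] in auto)
    \<comment> \<open>the lower limit of the sets \<open>B m\<close>, which is their limit because \<open>\<omega>\<close> is eventually constant along the times\<close>
    have "{\<omega> \<in> ?\<Omega>. \<omega> s \<in> A} = (\<Union>M. \<Inter>m\<in>{M..}. B m)"
    proof (intro set_eqI iffI)
      fix \<omega> assume "\<omega> \<in> {\<omega> \<in> ?\<Omega>. \<omega> s \<in> A}"
      hence w: "\<omega> \<in> ?\<Omega>" "\<omega> s \<in> A" by auto
      obtain M where "\<And>m. m \<ge> M \<Longrightarrow> \<omega> (t * real (k m) / 2 ^ m) = \<omega> s"
        using ev[OF w(1)] by (auto simp: eventually_sequentially)
      hence "\<omega> \<in> B m" if "m \<ge> M" for m using that B[OF w(1)] w(2) by simp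
      thus "\<omega> \<in> (\<Union>M. \<Inter>m\<in>{M..}. B m)" by auto
    next
      fix \<omega> assume "\<omega> \<in> (\<Union>M. \<Inter>m\<in>{M..}. B m)"
      then obtain M where M: "\<And>m. m \<ge> M \<Longrightarrow> \<omega> \<in> B m" by auto
      have w: "\<omega> \<in> ?\<Omega>" using M[of M] by (simp add: B_def sample_event_def)
      obtain M' where "\<And>m. m \<ge> M' \<Longrightarrow> \<omega> (t * real (k m) / 2 ^ m) = \<omega> s"
        using ev[OF w] by (auto simp: eventually_sequentially)
      hence "\<omega> s \<in> A" using B[OF w, of "max M M'"] M[of "max M M'"] by simp
      thus "\<omega> \<in> {\<omega> \<in> ?\<Omega>. \<omega> s \<in> A}" using w by simp
    qed
    also have "\<dots> \<in> sigma_sets ?\<Omega> ?G"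
    proof -
      have "B m \<in> sigma_sets ?\<Omega> ?G" for m
        unfolding B_def by (rule sigma_sets.Basic) auto
      hence "(\<Inter>m\<in>{M..}. B m) \<in> sigma_sets ?\<Omega> ?G" for M
        by (intro G.countable_INT) auto
      thus ?thesis by (intro G.countable_nat_UN) auto
    qed
    finally show "{\<omega> \<in> ?\<Omega>. \<omega> s \<in> A} \<in> sigma_sets ?\<Omega> ?G" .
  qed
qed

text \<open>A sample takes finitely many values, each with the probability prescribed by the finite-dimensional
  distributions; values that do not start in \<open>x\<close> have probability \<open>0\<close>.\<close>

lemma integral_function_of_sample:
  fixes \<phi> :: "(nat \<Rightarrow> 's) \<Rightarrow> real"
  assumes S: "finite S" and t: "t \<ge> 0" and P: "ctmc_law S q x P"
  shows "(\<integral>\<omega>. \<phi> (sample t m \<omega>) \<partial>P)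
    = (\<Sum>y\<in>paths_from S x (2 ^ m). \<phi> y * path_weight (transition S q (t / 2 ^ m)) (2 ^ m) y)"
proof -
  interpret prob_space P using P by (simp add: ctmc_law_def)
  have sets: "sets P = sets (path_space S)" using P by (simp add: ctmc_law_def)
  have space: "space P = space (path_space S)" by (rule sets_eq_imp_space_eq[OF sets])
  let ?Y = "{..2 ^ m :: nat} \<rightarrow>\<^sub>E S"
  have finY: "finite ?Y" using S by (simp add: finite_PiE)
  define C where "C y = {\<omega> \<in> space P. \<forall>i\<le>2 ^ m. \<omega> (t * real i / 2 ^ m) = y i}" for y :: "nat \<Rightarrow> 's"
  have C_sample: "\<omega> \<in> C y \<longleftrightarrow> sample t m \<omega> = y" if "\<omega> \<in> space P" "y \<in> ?Y" for \<omega> y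
    using that by (auto simp: C_def sample_def fun_eq_iff PiE_def extensional_def)
  have C_meas: "C y \<in> sets P" if y: "y \<in> ?Y" for y
  proof -
    have "C y = sample_event S t m {y}"
      using C_sample[OF _ y] by (auto simp: sample_event_def space C_def)
    thus ?thesis using sample_event_measurable[OF S t] subalgebra_natural_filtration[OF sets, of t]
      by (auto simp: subalgebra_def)
  qed
  have prob_C: "prob (C y) = (if y 0 = x then 1 else 0) * path_weight (transition S q (t / 2 ^ m)) (2 ^ m) y"
    if y: "y \<in> ?Y" for y
  proof -
    have law: "\<lbrakk>\<tau> 0 = 0; \<forall>i<k. \<tau> i \<le> \<tau> (Suc i); \<forall>i\<le>k. y i \<in> S\<rbrakk> \<Longrightarrow>
        measure P {\<omega> \<in> space P. \<forall>i\<le>k. \<omega> (\<tau> i) = y i} =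
          (if y 0 = x then 1 else 0) * (\<Prod>i<k. transition S q (\<tau> (Suc i) - \<tau> i) (y i) (y (Suc i)))"
      for k \<tau> using P unfolding ctmc_law_def by blast
    have "t * real (Suc i) / 2 ^ m - t * real i / 2 ^ m = t / 2 ^ m" for i
      by (simp add: field_simps)
    moreover have "t * real i / 2 ^ m \<le> t * real (Suc i) / 2 ^ m" for i
      using t by (intro divide_right_mono mult_left_mono) auto
    ultimately show ?thesis
      using law[of "\<lambda>i. t * real i / 2 ^ m" "2 ^ m"] y by (simp add: C_def path_weight_def PiE_iff)
  qed
  have "(\<integral>\<omega>. \<phi> (sample t m \<omega>) \<partial>P) = (\<integral>\<omega>. (\<Sum>y\<in>?Y. \<phi> y * indicator (C y) \<omega>) \<partial>P)"
  proof (rule Bochner_Integration.integral_cong[OF refl])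
    fix \<omega> assume w: "\<omega> \<in> space P"
    hence y: "sample t m \<omega> \<in> ?Y" using sample_in_paths[OF _ t] by (simp add: space)
    have "(\<Sum>y\<in>?Y. \<phi> y * indicator (C y) \<omega>) = (\<Sum>y\<in>?Y. if sample t m \<omega> = y then \<phi> y else 0)"
      by (rule sum.cong) (use C_sample[OF w] in \<open>auto simp: indicator_def\<close>)
    thus "\<phi> (sample t m \<omega>) = (\<Sum>y\<in>?Y. \<phi> y * indicator (C y) \<omega>)" using finY y by simp
  qed
  also have "\<dots> = (\<Sum>y\<in>?Y. \<integral>\<omega>. \<phi> y * indicator (C y) \<omega> \<partial>P)"
    by (intro Bochner_Integration.integral_sum integrable_mult_right integrable_real_indicator C_meas)
       (auto simp: emeasure_eq_measure)
  also have "\<dots> = (\<Sum>y\<in>?Y. \<phi> y * prob (C y))"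
    by (rule sum.cong[OF refl]) (simp add: sets.Int_space_eq2[OF C_meas])
  also have "\<dots> = (\<Sum>y\<in>paths_from S x (2 ^ m). \<phi> y * path_weight (transition S q (t / 2 ^ m)) (2 ^ m) y)"
    by (rule sum.mono_neutral_cong_right) (use finY prob_C in \<open>auto simp: paths_from_def\<close>)
  finally show ?thesis .
qed

section \<open>Change of measure between conjugate chains\<close>

text \<open>Two chains on a finite set whose generators satisfy \<open>Q2 = g Q1 g\<inverse> + V\<close>, with a positive function \<open>g\<close>
  and a potential \<open>V\<close> read as diagonal matrices.\<close>

locale conjugate_chains =
  fixes S :: "'s set" and q\<^sub>1 q\<^sub>2 :: "'s \<Rightarrow> 's \<Rightarrow> real" and g V :: "'s \<Rightarrow> real"
    and x :: 's and t :: real and P\<^sub>1 P\<^sub>2 :: "(real \<Rightarrow> 's) measure"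
  assumes finite_S: "finite S" and x: "x \<in> S" and t: "t \<ge> 0"
    and g_pos: "\<And>y. y \<in> S \<Longrightarrow> g y > 0"
    and conjugate: "\<And>y z. y \<in> S \<Longrightarrow> z \<in> S \<Longrightarrow>
      generator S q\<^sub>2 y z = g y / g z * generator S q\<^sub>1 y z + (if y = z then V z else 0)"
    and law\<^sub>1: "ctmc_law S q\<^sub>1 x P\<^sub>1" and law\<^sub>2: "ctmc_law S q\<^sub>2 x P\<^sub>2"
begin

abbreviation "F \<equiv> natural_filtration S t"

definition dens :: "(real \<Rightarrow> 's) \<Rightarrow> real" where
  "dens \<omega> = g (\<omega> 0) / g (\<omega> t) * exp (LINT s:{0..t}|lborel. V (\<omega> s))"

text \<open>The density with its integral replaced by the Riemann sum over right endpoints, as a function of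
  the sample.\<close>

definition sampled_dens :: "nat \<Rightarrow> (nat \<Rightarrow> 's) \<Rightarrow> real" where
  "sampled_dens m y = g (y 0) / g (y (2 ^ m)) * exp (\<Sum>i<2 ^ m. t / 2 ^ m * V (y (Suc i)))"

text \<open>The matrix \<open>g exp(\<delta> Q1) g\<inverse> exp(\<delta> V)\<close>. The potential acts after the transition since the
  Riemann sums use right endpoints.\<close>

definition tilted :: "real \<Rightarrow> 's \<Rightarrow> 's \<Rightarrow> real" where
  "tilted \<delta> y z = g y / g z * (exp (\<delta> * V z) * transition S q\<^sub>1 \<delta> y z)"

text \<open>The factors \<open>g (y i) / g (y (i + 1))\<close> telescope, and the exponential of the Riemann sum distributes over the
  steps.\<close>

lemma sampled_dens_times_weight:
  assumes y: "y \<in> paths_from S x (2 ^ m)"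
  shows "sampled_dens m y * path_weight (transition S q\<^sub>1 (t / 2 ^ m)) (2 ^ m) y
    = path_weight (tilted (t / 2 ^ m)) (2 ^ m) y"
proof -
  have "y i \<in> S" if "i \<le> 2 ^ m" for i using y that by (auto simp: paths_from_def PiE_def)
  hence "g (y i) \<noteq> 0" if "i \<le> 2 ^ m" for i using g_pos that by fastforce
  hence "(\<Prod>i<2 ^ m. g (y i) / g (y (Suc i))) = g (y 0) / g (y (2 ^ m))"
    using prod_lessThan_telescope'[of "2 ^ m" "\<lambda>i. g (y i)"] by auto
  moreover have "exp (\<Sum>i<2 ^ m. t / 2 ^ m * V (y (Suc i))) = (\<Prod>i<(2::nat) ^ m. exp (t / 2 ^ m * V (y (Suc i))))"
    by (simp add: exp_sum)
  ultimately show ?thesis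
    unfolding sampled_dens_def path_weight_def tilted_def prod.distrib by (simp only: mult.assoc)
qed

lemma tilted_at_zero: "y \<in> S \<Longrightarrow> tilted 0 y z = (if y = z then 1 else 0)"
  using g_pos[of y] by (auto simp: tilted_def transition_at_zero)

text \<open>This is where the relation between the two generators enters: the product rule at \<open>\<delta> = 0\<close> yields
  \<open>g Q1 g\<inverse> + V\<close>.\<close>

lemma tilted_has_derivative:
  assumes "y \<in> S" "z \<in> S"
  shows "((\<lambda>\<delta>. tilted \<delta> y z) has_real_derivative generator S q\<^sub>2 y z) (at 0)"
proof -
  note transition_has_derivative_generator[OF finite_S assms, of q\<^sub>1, derivative_intros]
  have "((\<lambda>\<delta>. tilted \<delta> y z) has_real_derivative
     g y / g z * (V z * transition S q\<^sub>1 0 y z + generator S q\<^sub>1 y z)) (at 0)"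
    unfolding tilted_def by (rule derivative_eq_intros refl | simp)+
  moreover have "g y / g z * (V z * transition S q\<^sub>1 0 y z + generator S q\<^sub>1 y z) = generator S q\<^sub>2 y z"
    using g_pos[OF assms(1)] conjugate[OF assms] by (auto simp: transition_at_zero distrib_left)
  ultimately show ?thesis by simp
qed

lemma sampled_dens_tendsto:
  assumes w: "\<omega> \<in> space (path_space S)"
  shows "(\<lambda>m. sampled_dens m (sample t m \<omega>)) \<longlonglongrightarrow> dens \<omega>"
proof -
  have "(\<lambda>m. \<Sum>i<2 ^ m. t / 2 ^ m * V (\<omega> (t * real (Suc i) / 2 ^ m)))
      \<longlonglongrightarrow> (LINT s:{0..t}|lborel. V (\<omega> s))"
  proof (rule dyadic_Riemann_sums[OF t, where K = "\<Sum>y\<in>S. \<bar>V y\<bar>"])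
    fix s :: real assume s: "s \<ge> 0"
    show "\<bar>V (\<omega> s)\<bar> \<le> (\<Sum>y\<in>S. \<bar>V y\<bar>)"
      by (rule member_le_sum) (use path_in_states[OF w s] finite_S in auto)
    have "\<forall>\<^sub>F u in at_right s. V (\<omega> u) = V (\<omega> s)"
      using path_right_continuous[OF w s] by eventually_elim simp
    thus "((\<lambda>u. V (\<omega> u)) \<longlongrightarrow> V (\<omega> s)) (at_right s)" by (rule tendsto_eventually)
  qed
  hence "(\<lambda>m. g (\<omega> 0) / g (\<omega> t) * exp (\<Sum>i<2 ^ m. t / 2 ^ m * V (\<omega> (t * real (Suc i) / 2 ^ m))))
      \<longlonglongrightarrow> dens \<omega>"
    unfolding dens_def by (intro tendsto_intros)
  moreover have "sampled_dens m (sample t m \<omega>)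
      = g (\<omega> 0) / g (\<omega> t) * exp (\<Sum>i<2 ^ m. t / 2 ^ m * V (\<omega> (t * real (Suc i) / 2 ^ m)))" for m
    by (simp add: sampled_dens_def sample_def Suc_le_eq)
  ultimately show ?thesis by simp
qed

text \<open>The bound is uniform in the grid, as dominated convergence requires.\<close>

lemma sampled_dens_bounded: 
  obtains K where "\<And>m y. y \<in> {..2 ^ m} \<rightarrow>\<^sub>E S \<Longrightarrow> \<bar>sampled_dens m y\<bar> \<le> K"
proof
  fix m and y :: "nat \<Rightarrow> 's" assume y: "y \<in> {..2 ^ m} \<rightarrow>\<^sub>E S"
  have yS: "y i \<in> S" if "i \<le> 2 ^ m" for i using y that by (auto simp: PiE_def)
  let ?V = "\<Sum>z\<in>S. \<bar>V z\<bar>" and ?G = "\<Sum>(u, v)\<in>S \<times> S. g u / g v"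
  have "(case (y 0, y (2 ^ m)) of (u, v) \<Rightarrow> g u / g v) \<le> ?G"
    by (rule member_le_sum) (use yS finite_S g_pos in \<open>auto intro!: divide_nonneg_nonneg less_imp_le\<close>)
  hence G: "g (y 0) / g (y (2 ^ m)) \<le> ?G" by simp
  have "V (y (Suc i)) \<le> ?V" if "i < 2 ^ m" for i
  proof -
    have "\<bar>V (y (Suc i))\<bar> \<le> ?V"
      by (rule member_le_sum) (use yS[of "Suc i"] that finite_S in auto)
    thus ?thesis by linarith
  qed
  hence "(\<Sum>i<2 ^ m. t / 2 ^ m * V (y (Suc i))) \<le> (\<Sum>i<(2::nat) ^ m. t / 2 ^ m * ?V)"
    using t by (intro sum_mono mult_left_mono) auto
  also have "\<dots> = t * ?V" by simp
  finally have "exp (\<Sum>i<2 ^ m. t / 2 ^ m * V (y (Suc i))) \<le> exp (t * ?V)" by simp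
  moreover have "g (y 0) / g (y (2 ^ m)) \<ge> 0" using g_pos yS by (simp add: less_imp_le)
  ultimately show "\<bar>sampled_dens m y\<bar> \<le> ?G * exp (t * ?V)"
    unfolding sampled_dens_def using G by (simp only: abs_mult abs_of_nonneg exp_ge_zero) (intro mult_mono, auto)
qed

lemma dens_measurable: "dens \<in> borel_measurable F"
  by (rule borel_measurable_LIMSEQ_real[OF _ function_of_sample_measurable[OF finite_S t]])
     (use sampled_dens_tendsto in \<open>simp add: space_natural_filtration\<close>)

lemma dens_nonneg: "\<omega> \<in> space (path_space S) \<Longrightarrow> dens \<omega> \<ge> 0"
  using path_in_states[of \<omega> S 0] path_in_states[of \<omega> S t] t g_pos by (simp add: dens_def less_imp_le)

lemma sets_P: "sets P\<^sub>1 = sets (path_space S)" "sets P\<^sub>2 = sets (path_space S)"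
  using law\<^sub>1 law\<^sub>2 by (auto simp: ctmc_law_def)

lemma space_P: "space P\<^sub>1 = space (path_space S)" "space P\<^sub>2 = space (path_space S)"
  using sets_P by (auto dest: sets_eq_imp_space_eq)

lemmas subalg = subalgebra_natural_filtration[OF sets_P(1), of t] subalgebra_natural_filtration[OF sets_P(2), of t]

text \<open>For every grid finer than the one of the event, the expectation of the sampled density over the event
  and the probability of the event under the second law are sums of path weights over the same set of discrete paths,
  and differ by at most the \<open>L\<^sup>1\<close>-distance of all path weights. Refine the grid.\<close>

lemma integral_dens_sample_event:
  "integrable P\<^sub>1 (\<lambda>\<omega>. indicator (sample_event S t m H) \<omega> * dens \<omega>)"
  "(\<integral>\<omega>. indicator (sample_event S t m H) \<omega> * dens \<omega> \<partial>P\<^sub>1) = measure P\<^sub>2 (sample_event S t m H)"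
proof -
  interpret P1: prob_space P\<^sub>1 using law\<^sub>1 by (simp add: ctmc_law_def)
  interpret P2: prob_space P\<^sub>2 using law\<^sub>2 by (simp add: ctmc_law_def)
  let ?G = "sample_event S t m H"
  let ?Z = "\<lambda>k \<omega>. sampled_dens k (sample t k \<omega>)"
  obtain K where K: "\<And>m y. y \<in> {..2 ^ m} \<rightarrow>\<^sub>E S \<Longrightarrow> \<bar>sampled_dens m y\<bar> \<le> K"
    using sampled_dens_bounded by blast
  have G: "?G \<in> sets F" by (rule sample_event_measurable[OF finite_S t])
  have meas: "(\<lambda>\<omega>. indicator ?G \<omega> * ?Z k \<omega>) \<in> borel_measurable P\<^sub>1" for k
    by (intro measurable_from_subalg[OF subalg(1)] borel_measurable_times borel_measurable_indicator
        function_of_sample_measurable finite_S t G)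
  have meas_dens: "(\<lambda>\<omega>. indicator ?G \<omega> * dens \<omega>) \<in> borel_measurable P\<^sub>1"
    by (intro measurable_from_subalg[OF subalg(1)] borel_measurable_times borel_measurable_indicator
        dens_measurable G)
  have lim: "AE \<omega> in P\<^sub>1. (\<lambda>k. indicator ?G \<omega> * ?Z k \<omega>) \<longlonglongrightarrow> indicator ?G \<omega> * dens \<omega>"
    by (rule AE_I2) (use sampled_dens_tendsto space_P in \<open>auto intro!: tendsto_intros\<close>)
  have bound: "AE \<omega> in P\<^sub>1. norm (indicator ?G \<omega> * ?Z k \<omega>) \<le> K" for k
  proof (rule AE_I2)
    fix \<omega> assume "\<omega> \<in> space P\<^sub>1"
    hence "\<bar>?Z k \<omega>\<bar> \<le> K" using sample_in_paths[OF _ t] by (intro K) (simp add: space_P)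
    thus "norm (indicator ?G \<omega> * ?Z k \<omega>) \<le> K" by (auto simp: indicator_def)
  qed
  show "integrable P\<^sub>1 (\<lambda>\<omega>. indicator ?G \<omega> * dens \<omega>)"
    by (rule integrable_dominated_convergence[OF meas_dens meas P1.integrable_const lim bound])
  have lim1: "(\<lambda>k. \<integral>\<omega>. indicator ?G \<omega> * ?Z k \<omega> \<partial>P\<^sub>1) \<longlonglongrightarrow> (\<integral>\<omega>. indicator ?G \<omega> * dens \<omega> \<partial>P\<^sub>1)"
    by (rule integral_dominated_convergence[OF meas_dens meas P1.integrable_const lim bound])
  define D where "D k = (\<Sum>y\<in>paths_from S x (2 ^ k).
     \<bar>path_weight (tilted (t / 2 ^ k)) (2 ^ k) y - path_weight (transition S q\<^sub>2 (t / 2 ^ k)) (2 ^ k) y\<bar>)" for k :: nat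
  have D: "D \<longlonglongrightarrow> 0"
    unfolding D_def
    by (rule path_weights_asymptotically_equal[OF finite_S x, where Q = "generator S q\<^sub>2"])
       (simp_all add: tilted_at_zero transition_at_zero tilted_has_derivative
         transition_has_derivative_generator[OF finite_S])
  have close: "\<bar>(\<integral>\<omega>. indicator ?G \<omega> * ?Z k \<omega> \<partial>P\<^sub>1) - measure P\<^sub>2 ?G\<bar> \<le> D k" if k: "k \<ge> m" for k
  proof -
    obtain H' where H': "?G = sample_event S t k H'" using sample_event_refine[OF k] by blast
    have ind: "indicator ?G \<omega> = (indicator H' (sample t k \<omega>) :: real)"
      if "\<omega> \<in> space (path_space S)" for \<omega>
      unfolding H' using that by (simp add: sample_event_def indicator_def)
    have "(\<integral>\<omega>. indicator ?G \<omega> * ?Z k \<omega> \<partial>P\<^sub>1)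
        = (\<integral>\<omega>. indicator H' (sample t k \<omega>) * sampled_dens k (sample t k \<omega>) \<partial>P\<^sub>1)"
      by (rule Bochner_Integration.integral_cong) (auto simp: ind space_P)
    also have "\<dots> = (\<Sum>y\<in>paths_from S x (2 ^ k). indicator H' y * sampled_dens k y *
        path_weight (transition S q\<^sub>1 (t / 2 ^ k)) (2 ^ k) y)"
      by (rule integral_function_of_sample[OF finite_S t law\<^sub>1])
    also have "\<dots> = (\<Sum>y\<in>paths_from S x (2 ^ k). indicator H' y * path_weight (tilted (t / 2 ^ k)) (2 ^ k) y)"
      by (rule sum.cong) (auto simp: sampled_dens_times_weight mult.assoc)
    finally have I1: "(\<integral>\<omega>. indicator ?G \<omega> * ?Z k \<omega> \<partial>P\<^sub>1) = \<dots>" .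
    have "measure P\<^sub>2 ?G = (\<integral>\<omega>. indicator ?G \<omega> \<partial>P\<^sub>2)"
      using G subalg(2) by (simp add: subalgebra_def subset_iff)
    also have "\<dots> = (\<integral>\<omega>. indicator H' (sample t k \<omega>) \<partial>P\<^sub>2)"
      by (rule Bochner_Integration.integral_cong) (auto simp: ind space_P)
    also have "\<dots> = (\<Sum>y\<in>paths_from S x (2 ^ k). indicator H' y * path_weight (transition S q\<^sub>2 (t / 2 ^ k)) (2 ^ k) y)"
      by (rule integral_function_of_sample[OF finite_S t law\<^sub>2])
    finally have "\<bar>(\<integral>\<omega>. indicator ?G \<omega> * ?Z k \<omega> \<partial>P\<^sub>1) - measure P\<^sub>2 ?G\<bar> =
      \<bar>\<Sum>y\<in>paths_from S x (2 ^ k). indicator H' y *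
        (path_weight (tilted (t / 2 ^ k)) (2 ^ k) y - path_weight (transition S q\<^sub>2 (t / 2 ^ k)) (2 ^ k) y)\<bar>"
      unfolding I1 by (simp add: sum_subtractf right_diff_distrib)
    also have "\<dots> \<le> D k"
      unfolding D_def by (rule order_trans[OF sum_abs], rule sum_mono) (simp add: indicator_def)
    finally show ?thesis .
  qed
  have "(\<lambda>k. (\<integral>\<omega>. indicator ?G \<omega> * ?Z k \<omega> \<partial>P\<^sub>1) - measure P\<^sub>2 ?G) \<longlonglongrightarrow> 0"
    by (rule Lim_null_comparison[OF _ D]) (use close in \<open>auto simp: eventually_sequentially\<close>)
  from LIMSEQ_unique[OF this tendsto_diff[OF lim1 tendsto_const]]
  show "(\<integral>\<omega>. indicator ?G \<omega> * dens \<omega> \<partial>P\<^sub>1) = measure P\<^sub>2 ?G" by simp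
qed

text \<open>Both sides are finite measures that agree on the sample events, an intersection-stable generator of
  the filtration.\<close>

lemma restricted_law_eq_density:
  "restr_to_subalg P\<^sub>2 F = density (restr_to_subalg P\<^sub>1 F) (\<lambda>\<omega>. ennreal (dens \<omega>))"
proof (rule measure_eqI_generator_eq[where \<Omega> = "space (path_space S)"
      and E = "{sample_event S t m H | m H. True}" and A = "\<lambda>_. sample_event S t 0 UNIV"])
  interpret P2: prob_space P\<^sub>2 using law\<^sub>2 by (simp add: ctmc_law_def)
  show "Int_stable {sample_event S t m H | m H. True}" by (rule Int_stable_sample_events)
  fix X assume "X \<in> {sample_event S t m H | m H. True}"
  then obtain m H where X: "X = sample_event S t m H" by auto
  have X_F: "X \<in> sets F" unfolding X by (rule sample_event_measurable[OF finite_S t])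
  have "emeasure (density (restr_to_subalg P\<^sub>1 F) (\<lambda>\<omega>. ennreal (dens \<omega>))) X
     = (\<integral>\<^sup>+\<omega>. ennreal (dens \<omega>) * indicator X \<omega> \<partial>restr_to_subalg P\<^sub>1 F)"
    by (rule emeasure_density)
       (use X_F dens_measurable in \<open>auto simp: sets_restr_to_subalg[OF subalg(1)] intro!: measurable_in_subalg[OF subalg(1)]\<close>)
  also have "\<dots> = (\<integral>\<^sup>+\<omega>. ennreal (dens \<omega>) * indicator X \<omega> \<partial>P\<^sub>1)"
    by (rule nn_integral_subalgebra2[OF subalg(1)]) (use X_F dens_measurable in measurable)
  also have "\<dots> = (\<integral>\<^sup>+\<omega>. ennreal (indicator X \<omega> * dens \<omega>) \<partial>P\<^sub>1)"
    by (rule nn_integral_cong) (simp add: indicator_def)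
  also have "\<dots> = ennreal (\<integral>\<omega>. indicator X \<omega> * dens \<omega> \<partial>P\<^sub>1)"
    unfolding X by (rule nn_integral_eq_integral[OF integral_dens_sample_event(1)])
       (rule AE_I2, use dens_nonneg in \<open>simp add: space_P\<close>)
  also have "\<dots> = emeasure P\<^sub>2 X"
    by (simp add: X integral_dens_sample_event(2) P2.emeasure_eq_measure)
  also have "\<dots> = emeasure (restr_to_subalg P\<^sub>2 F) X"
    by (rule emeasure_restr_to_subalg[OF subalg(2) X_F, symmetric])
  finally show "emeasure (restr_to_subalg P\<^sub>2 F) X
      = emeasure (density (restr_to_subalg P\<^sub>1 F) (\<lambda>\<omega>. ennreal (dens \<omega>))) X" by simp
next
  interpret R: prob_space "restr_to_subalg P\<^sub>2 F"
    by (rule prob_space_restr_to_subalg[OF subalg(2)]) (use law\<^sub>2 in \<open>simp add: ctmc_law_def\<close>)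
  show "emeasure (restr_to_subalg P\<^sub>2 F) (sample_event S t 0 UNIV) \<noteq> \<infinity>" by simp
qed (use sets_restr_to_subalg[OF subalg(1)] sets_restr_to_subalg[OF subalg(2)]
       sample_events_generate_filtration[OF finite_S t] in \<open>auto simp: sample_event_def\<close>)

lemma RN_deriv_eq_dens:
  "AE \<omega> in restr_to_subalg P\<^sub>1 F. RN_deriv (restr_to_subalg P\<^sub>1 F) (restr_to_subalg P\<^sub>2 F) \<omega> = ennreal (dens \<omega>)"
proof -
  interpret R: prob_space "restr_to_subalg P\<^sub>1 F"
    by (rule prob_space_restr_to_subalg[OF subalg(1)]) (use law\<^sub>1 in \<open>simp add: ctmc_law_def\<close>)
  have "AE \<omega> in restr_to_subalg P\<^sub>1 F. ennreal (dens \<omega>) = RN_deriv (restr_to_subalg P\<^sub>1 F) (restr_to_subalg P\<^sub>2 F) \<omega>"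
    by (rule R.RN_deriv_unique[OF _ restricted_law_eq_density[symmetric]])
       (use measurable_in_subalg[OF subalg(1) dens_measurable] in measurable)
  thus ?thesis by eventually_elim simp
qed

end

theorem theorem1p12:
  fixes n l :: nat and E :: "nat set" and t :: real
    and P P_tasep :: "(real \<Rightarrow> nat set) measure"
  assumes "n \<ge> 2" and "1 \<le> l" and "l \<le> n - 1"
    and "E \<in> configs n l" and "t \<ge> 0"
    and "ctmc_law (configs n l) (walker_rate n) E P"
    and "ctmc_law (configs n l) (tasep_rate n) E P_tasep"
  defines "F \<equiv> natural_filtration (configs n l) t"
  shows "tasep_density n l t \<in> borel_measurable F
    \<and> restr_to_subalg P_tasep F
        = density (restr_to_subalg P F) (\<lambda>\<omega>. ennreal (tasep_density n l t \<omega>))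
    \<and> (AE \<omega> in restr_to_subalg P F.
        RN_deriv (restr_to_subalg P F) (restr_to_subalg P_tasep F) \<omega>
          = ennreal (tasep_density n l t \<omega>))"
proof -
  interpret conjugate_chains "configs n l" "walker_rate n" "tasep_rate n" "Vandermonde n"
    "\<lambda>y. real (Traffic n y) - c_const n l" E t P P_tasep
    by unfold_locales
      (use assms finite_configs Vandermonde_pos tasep_generator_conjugate in auto)
  have "dens = tasep_density n l t"
    by (simp add: fun_eq_iff dens_def tasep_density_def)
  thus ?thesis
    unfolding F_def using dens_measurable restricted_law_eq_density RN_deriv_eq_dens by simp
qed

end
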